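(* Let $S$ be a discrete unital semigroup with identity $e_S$, let $\omega$ be a weight on $S$ with $\omega(e_S)=1$, and let $\mathcal{A}:=\ell^1(S,\omega)$. Consider the following statements: (1) $\mathcal{A}$ is pointwise amenable. (2) For each $k\in S$ there exists $M\in(\mathcal{A}\hat{\otimes}\mathcal{A})^{**}=\ell^\infty(S\times S)^*$ such that: (i) $\big\langle\big(f(hk,g)\,\Omega(h,k)-f(h,kg)\,\Omega(k,g)\big)_{(g,h)\in S\times S},\,M\big\rangle=0$ for each bounded function $f:S\times S\to\mathbb{C}$; (ii) $\big\langle\big(f_{gh}\,\Omega(g,h)\big)_{(g,h)\in S\times S},\,M\big\rangle=f_{e_S}$ for each bounded family $(f_g)_{g\in S}$ of complex numbers. (3) $\mathcal{A}$ is pointwise amenable at $\delta_k$ for each $k\in S$. Then $(1)\Longrightarrow(2)\Longrightarrow(3)$.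
   Context: A weight on a discrete semigroup $S$ is a function $\omega:S\to[1,\infty)$ with $\omega(gh)\le\omega(g)\omega(h)$ for all $g,h\in S$. Put $\Omega(g,h):=\dfrac{\omega(gh)}{\omega(g)\omega(h)}$ for $g,h\in S$. The Beurling algebra $\ell^1(S,\omega)$ is regarded as the Banach space $\ell^1(S)$ with the product $\delta_g\star_\omega\delta_h:=\Omega(g,h)\,\delta_{gh}$, extended by linearity and continuity, where $\delta_g$ is the characteristic function of $\{g\}$. The projective tensor product $\ell^1(S)\hat{\otimes}\ell^1(S)$ is identified with $\ell^1(S\times S)$ via $\delta_g\otimes\delta_h\leftrightarrow\delta_{(g,h)}$, so its dual is $\ell^\infty(S\times S)$ and its bidual is $\ell^\infty(S\times S)^*$. A derivation from a Banach algebra $\mathcal{A}$ to a Banach $\mathcal{A}$-bimodule is a bounded linear map $D$ with $D(ab)=D(a)\cdot b+a\cdot D(b)$. $\mathcal{A}$ is pointwise amenable at $a_0\in\mathcal{A}$ if for every Banach $\mathcal{A}$-bimodule $E$ and every derivation $D:\mathcal{A}\to E^*$ there is $\phi\in E^*$ with $D(a_0)=a_0\cdot\phi-\phi\cdot a_0$. $\mathcal{A}$ is pointwise amenable if it is pointwise amenable at each $a_0\in\mathcal{A}$. *)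

theory Defs
  imports Complex_Main "HOL-Analysis.Elementary_Metric_Spaces" "HOL-Analysis.Infinite_Sum" "HOL-Algebra.Module" "HOL-Algebra.Algebraic_Closure_Type"
begin

section \<open>Complex Banach spaces on a carrier\<close>

text \<open>
  Pointwise amenability quantifies over all Banach bimodules, so these spaces have to be
  objects and cannot be types of class \<^class>\<open>banach\<close>.  They are modules in the sense of
  HOL-Algebra over the field of complex numbers, together with a norm.  The fields \<^const>\<open>mult\<close>
  and \<^const>\<open>one\<close> of the underlying record have a meaning only for algebras.
\<close>

record 'v normed_space = "(complex, 'v) module" +
  vnorm :: "'v \<Rightarrow> real"

locale complex_banach_space =
  module "ring_of_type_algebra :: complex ring" V
  for V :: "('v, 'm) normed_space_scheme" (structure) +
  assumes vnorm_nonneg: "x \<in> carrier V \<Longrightarrow> 0 \<le> vnorm V x"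
    and vnorm_eq_0_iff: "x \<in> carrier V \<Longrightarrow> vnorm V x = 0 \<longleftrightarrow> x = \<zero>\<^bsub>V\<^esub>"
    and vnorm_triangle:
      "\<lbrakk>x \<in> carrier V; y \<in> carrier V\<rbrakk> \<Longrightarrow> vnorm V (x \<oplus>\<^bsub>V\<^esub> y) \<le> vnorm V x + vnorm V y"
    and vnorm_smult: "x \<in> carrier V \<Longrightarrow> vnorm V (c \<odot>\<^bsub>V\<^esub> x) = cmod c * vnorm V x"
    and complete:
      "\<lbrakk>\<And>n. u n \<in> carrier V;
        \<forall>\<epsilon>>0. \<exists>N. \<forall>m\<ge>N. \<forall>n\<ge>N. vnorm V (u m \<ominus>\<^bsub>V\<^esub> u n) < \<epsilon>\<rbrakk>
       \<Longrightarrow> \<exists>x\<in>carrier V. (\<lambda>n::nat. vnorm V (u n \<ominus>\<^bsub>V\<^esub> x)) \<longlonglongrightarrow> 0"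

text \<open>Functionals are \<^const>\<open>extensional\<close> on the carrier, so that equal functionals are
  equal as functions.\<close>

definition dual_space :: "('v, 'm) normed_space_scheme \<Rightarrow> ('v \<Rightarrow> complex) normed_space" where
  "dual_space V =
    \<lparr>carrier = {\<phi> \<in> extensional (carrier V).
        (\<forall>x\<in>carrier V. \<forall>y\<in>carrier V. \<phi> (x \<oplus>\<^bsub>V\<^esub> y) = \<phi> x + \<phi> y) \<and>
        (\<forall>c. \<forall>x\<in>carrier V. \<phi> (c \<odot>\<^bsub>V\<^esub> x) = c * \<phi> x) \<and>
        (\<exists>C. \<forall>x\<in>carrier V. cmod (\<phi> x) \<le> C * vnorm V x)},
     mult = undefined, one = undefined,
     zero = (\<lambda>x\<in>carrier V. 0),
     add = (\<lambda>\<phi> \<psi>. \<lambda>x\<in>carrier V. \<phi> x + \<psi> x),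
     module.smult = (\<lambda>c \<phi>. \<lambda>x\<in>carrier V. c * \<phi> x),
     vnorm = (\<lambda>\<phi>. SUP x\<in>{x \<in> carrier V. vnorm V x \<le> 1}. cmod (\<phi> x))\<rparr>"

definition linf_space :: "('i \<Rightarrow> complex) normed_space" where
  "linf_space =
    \<lparr>carrier = {f. bounded (range f)},
     mult = undefined, one = undefined,
     zero = (\<lambda>_. 0),
     add = (\<lambda>f g i. f i + g i),
     module.smult = (\<lambda>c f i. c * f i),
     vnorm = (\<lambda>f. SUP i. cmod (f i))\<rparr>"


section \<open>Banach bimodules, derivations and pointwise amenability\<close>

record ('a, 'v) bimodule = "'v normed_space" +
  lact :: "'a \<Rightarrow> 'v \<Rightarrow> 'v"
  ract :: "'v \<Rightarrow> 'a \<Rightarrow> 'v"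

text \<open>The module actions are jointly bounded, not necessarily contractive or unital.\<close>

locale banach_bimodule =
  complex_banach_space E
  for A :: "('a, 'm) normed_space_scheme" and E :: "('a, 'v, 'n) bimodule_scheme" (structure) +
  assumes lact_closed: "\<lbrakk>a \<in> carrier A; x \<in> carrier E\<rbrakk> \<Longrightarrow> lact E a x \<in> carrier E"
    and ract_closed: "\<lbrakk>a \<in> carrier A; x \<in> carrier E\<rbrakk> \<Longrightarrow> ract E x a \<in> carrier E"
    and lact_add_left: "\<lbrakk>a \<in> carrier A; b \<in> carrier A; x \<in> carrier E\<rbrakk>
      \<Longrightarrow> lact E (a \<oplus>\<^bsub>A\<^esub> b) x = lact E a x \<oplus>\<^bsub>E\<^esub> lact E b x"
    and lact_add_right: "\<lbrakk>a \<in> carrier A; x \<in> carrier E; y \<in> carrier E\<rbrakk>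
      \<Longrightarrow> lact E a (x \<oplus>\<^bsub>E\<^esub> y) = lact E a x \<oplus>\<^bsub>E\<^esub> lact E a y"
    and lact_smult_left: "\<lbrakk>a \<in> carrier A; x \<in> carrier E\<rbrakk>
      \<Longrightarrow> lact E (c \<odot>\<^bsub>A\<^esub> a) x = c \<odot>\<^bsub>E\<^esub> lact E a x"
    and lact_smult_right: "\<lbrakk>a \<in> carrier A; x \<in> carrier E\<rbrakk>
      \<Longrightarrow> lact E a (c \<odot>\<^bsub>E\<^esub> x) = c \<odot>\<^bsub>E\<^esub> lact E a x"
    and ract_add_left: "\<lbrakk>a \<in> carrier A; x \<in> carrier E; y \<in> carrier E\<rbrakk>
      \<Longrightarrow> ract E (x \<oplus>\<^bsub>E\<^esub> y) a = ract E x a \<oplus>\<^bsub>E\<^esub> ract E y a"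
    and ract_add_right: "\<lbrakk>a \<in> carrier A; b \<in> carrier A; x \<in> carrier E\<rbrakk>
      \<Longrightarrow> ract E x (a \<oplus>\<^bsub>A\<^esub> b) = ract E x a \<oplus>\<^bsub>E\<^esub> ract E x b"
    and ract_smult_left: "\<lbrakk>a \<in> carrier A; x \<in> carrier E\<rbrakk>
      \<Longrightarrow> ract E (c \<odot>\<^bsub>E\<^esub> x) a = c \<odot>\<^bsub>E\<^esub> ract E x a"
    and ract_smult_right: "\<lbrakk>a \<in> carrier A; x \<in> carrier E\<rbrakk>
      \<Longrightarrow> ract E x (c \<odot>\<^bsub>A\<^esub> a) = c \<odot>\<^bsub>E\<^esub> ract E x a"
    and lact_mult: "\<lbrakk>a \<in> carrier A; b \<in> carrier A; x \<in> carrier E\<rbrakk>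
      \<Longrightarrow> lact E (a \<otimes>\<^bsub>A\<^esub> b) x = lact E a (lact E b x)"
    and ract_mult: "\<lbrakk>a \<in> carrier A; b \<in> carrier A; x \<in> carrier E\<rbrakk>
      \<Longrightarrow> ract E x (a \<otimes>\<^bsub>A\<^esub> b) = ract E (ract E x a) b"
    and lact_ract: "\<lbrakk>a \<in> carrier A; b \<in> carrier A; x \<in> carrier E\<rbrakk>
      \<Longrightarrow> lact E a (ract E x b) = ract E (lact E a x) b"
    and lact_bounded: "\<exists>C. \<forall>a\<in>carrier A. \<forall>x\<in>carrier E.
        vnorm E (lact E a x) \<le> C * vnorm A a * vnorm E x"
    and ract_bounded: "\<exists>C. \<forall>a\<in>carrier A. \<forall>x\<in>carrier E.
        vnorm E (ract E x a) \<le> C * vnorm A a * vnorm E x"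

text \<open>The dual bimodule, with \<open>\<langle>x, a \<cdot> \<phi>\<rangle> = \<langle>x \<cdot> a, \<phi>\<rangle>\<close> and
  \<open>\<langle>x, \<phi> \<cdot> a\<rangle> = \<langle>a \<cdot> x, \<phi>\<rangle>\<close>.\<close>

definition dual_bimodule :: "('a, 'v) bimodule \<Rightarrow> ('a, 'v \<Rightarrow> complex) bimodule" where
  "dual_bimodule E = normed_space.extend (dual_space E)
    (bimodule.fields
      (\<lambda>a \<phi>. \<lambda>x\<in>carrier E. \<phi> (ract E x a))
      (\<lambda>\<phi> a. \<lambda>x\<in>carrier E. \<phi> (lact E a x)))"

definition derivation ::
    "('a, 'm) normed_space_scheme \<Rightarrow> ('a, 'v) bimodule \<Rightarrow> ('a \<Rightarrow> 'v) \<Rightarrow> bool" where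
  "derivation A Y D \<longleftrightarrow>
    D \<in> carrier A \<rightarrow> carrier Y \<and>
    (\<forall>a\<in>carrier A. \<forall>b\<in>carrier A. D (a \<oplus>\<^bsub>A\<^esub> b) = D a \<oplus>\<^bsub>Y\<^esub> D b) \<and>
    (\<forall>c. \<forall>a\<in>carrier A. D (c \<odot>\<^bsub>A\<^esub> a) = c \<odot>\<^bsub>Y\<^esub> D a) \<and>
    (\<exists>C. \<forall>a\<in>carrier A. vnorm Y (D a) \<le> C * vnorm A a) \<and>
    (\<forall>a\<in>carrier A. \<forall>b\<in>carrier A.
      D (a \<otimes>\<^bsub>A\<^esub> b) = ract Y (D a) b \<oplus>\<^bsub>Y\<^esub> lact Y a (D b))"

text \<open>
  HOL cannot quantify over types inside a formula.  The type argument is therefore a universe: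
  \<open>E\<close> ranges over all Banach bimodules whose carrier is a subset of that type.  Amenability over
  one universe implies amenability over every universe that injects into it, and it is
  universe-free amenability as soon as the universe contains a copy of each countably generated
  closed sub-bimodule (restrict a derivation to these; the implementing functionals have a uniform
  norm bound, and a weak-star cluster point of them implements the derivation).  For \<open>\<ell>\<^sup>1(S, \<omega>)\<close> such
  a sub-bimodule has at most as many elements as the type of functions from \<open>S \<times> S\<close> to \<open>complex\<close>.
\<close>

definition pointwise_amenable_at ::
    "'v itself \<Rightarrow> ('a, 'm) normed_space_scheme \<Rightarrow> 'a \<Rightarrow> bool" where
  "pointwise_amenable_at _ A a\<^sub>0 \<longleftrightarrow>
    (\<forall>E :: ('a, 'v) bimodule. banach_bimodule A E \<longrightarrow>
      (\<forall>D. derivation A (dual_bimodule E) D \<longrightarrow>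
        (\<exists>\<phi>\<in>carrier (dual_bimodule E).
          D a\<^sub>0 = lact (dual_bimodule E) a\<^sub>0 \<phi> \<ominus>\<^bsub>dual_bimodule E\<^esub> ract (dual_bimodule E) \<phi> a\<^sub>0)))"

definition pointwise_amenable :: "'v itself \<Rightarrow> ('a, 'm) normed_space_scheme \<Rightarrow> bool" where
  "pointwise_amenable U A \<longleftrightarrow> (\<forall>a\<^sub>0\<in>carrier A. pointwise_amenable_at U A a\<^sub>0)"


section \<open>Weights and Beurling algebras\<close>

definition weight :: "('s::semigroup_mult \<Rightarrow> real) \<Rightarrow> bool" where
  "weight \<omega> \<longleftrightarrow> (\<forall>g. 1 \<le> \<omega> g) \<and> (\<forall>g h. \<omega> (g * h) \<le> \<omega> g * \<omega> h)"

definition weight_ratio :: "('s::semigroup_mult \<Rightarrow> real) \<Rightarrow> 's \<Rightarrow> 's \<Rightarrow> complex" where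
  "weight_ratio \<omega> g h = of_real (\<omega> (g * h) / (\<omega> g * \<omega> h))"

definition point_mass :: "'s \<Rightarrow> 's \<Rightarrow> complex" where
  "point_mass g = indicator {g}"

definition beurling_mult ::
    "('s::semigroup_mult \<Rightarrow> real) \<Rightarrow> ('s \<Rightarrow> complex) \<Rightarrow> ('s \<Rightarrow> complex) \<Rightarrow> 's \<Rightarrow> complex" where
  "beurling_mult \<omega> a b x =
    (\<Sum>\<^sub>\<infinity>(g, h)\<in>{(g, h). g * h = x}. a g * b h * weight_ratio \<omega> g h)"

definition beurling_algebra :: "('s::monoid_mult \<Rightarrow> real) \<Rightarrow> ('s \<Rightarrow> complex) normed_space" where
  "beurling_algebra \<omega> =
    \<lparr>carrier = {a. (\<lambda>g. cmod (a g)) summable_on UNIV},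
     mult = beurling_mult \<omega>,
     one = point_mass 1,
     zero = (\<lambda>_. 0),
     add = (\<lambda>a b g. a g + b g),
     module.smult = (\<lambda>c a g. c * a g),
     vnorm = (\<lambda>a. \<Sum>\<^sub>\<infinity>g. cmod (a g))\<rparr>"

text \<open>On \<open>\<ell>\<^sup>1\<close> the sum defining \<^const>\<open>beurling_mult\<close> converges absolutely, and the following three
  facts identify it with the continuous bilinear extension of the product of point masses.\<close>

lemma beurling_mult_point_mass:
  "beurling_mult \<omega> (point_mass g) (point_mass h) = (\<lambda>x. weight_ratio \<omega> g h * point_mass (g * h) x)"
proof
  fix x
  have "beurling_mult \<omega> (point_mass g) (point_mass h) x =
    (\<Sum>\<^sub>\<infinity>p\<in>{(g, h)} \<inter> {(g, h). g * h = x}. case p of (g', h') \<Rightarrow>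
      point_mass g g' * point_mass h h' * weight_ratio \<omega> g' h')"
    unfolding beurling_mult_def
    by (rule infsum_cong_neutral) (auto simp: point_mass_def indicator_def split: if_splits)
  also have "\<dots> = weight_ratio \<omega> g h * point_mass (g * h) x"
    by (cases "g * h = x") (auto simp: point_mass_def)
  finally show "beurling_mult \<omega> (point_mass g) (point_mass h) x = \<dots>" .
qed

lemma weight_ratio_norm:
  assumes "weight \<omega>"
  shows "cmod (weight_ratio \<omega> g h) \<le> 1"
proof -
  have *: "1 \<le> \<omega> g" "1 \<le> \<omega> h" "1 \<le> \<omega> (g * h)" "\<omega> (g * h) \<le> \<omega> g * \<omega> h"
    using assms unfolding weight_def by auto
  moreover from * have "0 < \<omega> g * \<omega> h" by (intro mult_pos_pos) linarith+
  ultimately show ?thesis unfolding weight_ratio_def norm_of_real by (simp add: divide_le_eq)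
qed

lemma beurling_mult_bounded:
  assumes w: "weight \<omega>" and a: "a abs_summable_on UNIV" and b: "b abs_summable_on UNIV"
  shows "(\<lambda>(g, h). a g * b h * weight_ratio \<omega> g h) abs_summable_on UNIV"
    and "beurling_mult \<omega> a b abs_summable_on UNIV"
    and "(\<Sum>\<^sub>\<infinity>x. cmod (beurling_mult \<omega> a b x)) \<le> (\<Sum>\<^sub>\<infinity>g. cmod (a g)) * (\<Sum>\<^sub>\<infinity>h. cmod (b h))"
proof -
  let ?t = "\<lambda>(g, h). a g * b h * weight_ratio \<omega> g h"
  let ?F = "\<lambda>x. {(g, h). g * h = x}"
  have ab: "(\<lambda>(g, h). a g * b h) abs_summable_on UNIV \<times> UNIV"
    using a b
    by (subst abs_summable_on_Sigma_iff)
      (auto simp: norm_mult infsum_cmult_right abs_mult infsum_nonneg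
        intro!: summable_on_cmult_right summable_on_cmult_left)
  have le: "norm (?t p) \<le> norm (case p of (g, h) \<Rightarrow> a g * b h)" for p
    using weight_ratio_norm[OF w] by (cases p) (auto simp: norm_mult intro!: mult_left_le)
  show t: "?t abs_summable_on UNIV"
    by (rule summable_on_comparison_test[where f = "\<lambda>p. norm (case p of (g, h) \<Rightarrow> a g * b h)"])
      (use ab le in auto)
  have bij: "bij_betw snd (Sigma UNIV ?F) UNIV"
    by (rule bij_betwI[where g = "\<lambda>(g, h). (g * h, (g, h))"]) auto
  have S: "(\<lambda>p. norm (?t (snd p))) summable_on Sigma UNIV ?F"
    using t summable_on_reindex_bij_betw[OF bij, of "\<lambda>p. norm (?t p)"] by simp
  then have "(\<lambda>p. ?t (snd p)) abs_summable_on Sigma UNIV ?F" by simp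
  then have fib: "?t abs_summable_on ?F x" for x
    by (subst (asm) abs_summable_on_Sigma_iff) auto
  have I: "(\<lambda>x. \<Sum>\<^sub>\<infinity>p\<in>?F x. norm (?t p)) summable_on UNIV"
    using summable_on_Sigma_banach[of "\<lambda>x p. norm (?t p)" UNIV ?F] S by (simp add: case_prod_unfold)
  have pt: "cmod (beurling_mult \<omega> a b x) \<le> (\<Sum>\<^sub>\<infinity>p\<in>?F x. norm (?t p))" for x
    unfolding beurling_mult_def using fib by (rule norm_infsum_bound)
  show sm: "beurling_mult \<omega> a b abs_summable_on UNIV"
    by (rule summable_on_comparison_test[OF I]) (use pt in auto)
  have "(\<Sum>\<^sub>\<infinity>x. cmod (beurling_mult \<omega> a b x)) \<le> (\<Sum>\<^sub>\<infinity>x. \<Sum>\<^sub>\<infinity>p\<in>?F x. norm (?t p))"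
    by (rule infsum_mono[OF sm I pt])
  also have "\<dots> = (\<Sum>\<^sub>\<infinity>p\<in>Sigma UNIV ?F. norm (?t (snd p)))"
    using infsum_Sigma'_banach[of "\<lambda>x p. norm (?t p)" UNIV ?F] S by (simp add: case_prod_unfold)
  also have "\<dots> = (\<Sum>\<^sub>\<infinity>p. norm (?t p))"
    using infsum_reindex_bij_betw[OF bij, of "\<lambda>p. norm (?t p)"] by simp
  also have "\<dots> \<le> (\<Sum>\<^sub>\<infinity>p\<in>UNIV \<times> UNIV. norm (case p of (g, h) \<Rightarrow> a g * b h))"
    using infsum_mono[OF t, of "\<lambda>p. norm (case p of (g, h) \<Rightarrow> a g * b h)"] ab le by simp
  also have "\<dots> = (\<Sum>\<^sub>\<infinity>g. \<Sum>\<^sub>\<infinity>h. cmod (a g) * cmod (b h))"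
    using infsum_Sigma'_banach[of "\<lambda>g h. cmod (a g * b h)" UNIV "\<lambda>_. UNIV"] ab
    by (simp add: case_prod_unfold norm_mult)
  also have "\<dots> = (\<Sum>\<^sub>\<infinity>g. cmod (a g)) * (\<Sum>\<^sub>\<infinity>h. cmod (b h))"
    by (simp add: infsum_cmult_right' infsum_cmult_left')
  finally show "(\<Sum>\<^sub>\<infinity>x. cmod (beurling_mult \<omega> a b x)) \<le> (\<Sum>\<^sub>\<infinity>g. cmod (a g)) * (\<Sum>\<^sub>\<infinity>h. cmod (b h))" .
qed

lemma beurling_mult_bilinear:
  assumes w: "weight \<omega>" and a: "a abs_summable_on UNIV" and b: "b abs_summable_on UNIV"
    and c: "c abs_summable_on UNIV"
  shows "beurling_mult \<omega> (\<lambda>g. a g + b g) c = (\<lambda>x. beurling_mult \<omega> a c x + beurling_mult \<omega> b c x)"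
    and "beurling_mult \<omega> a (\<lambda>g. b g + c g) = (\<lambda>x. beurling_mult \<omega> a b x + beurling_mult \<omega> a c x)"
    and "beurling_mult \<omega> (\<lambda>g. z * a g) b = (\<lambda>x. z * beurling_mult \<omega> a b x)"
    and "beurling_mult \<omega> a (\<lambda>g. z * b g) = (\<lambda>x. z * beurling_mult \<omega> a b x)"
proof -
  have s: "(\<lambda>(g, h). u g * v h * weight_ratio \<omega> g h) summable_on B"
    if "u abs_summable_on UNIV" "v abs_summable_on UNIV" for u v B
    by (rule summable_on_subset_banach[OF abs_summable_summable[OF beurling_mult_bounded(1)[OF w that]]]) simp
  show "beurling_mult \<omega> (\<lambda>g. a g + b g) c = (\<lambda>x. beurling_mult \<omega> a c x + beurling_mult \<omega> b c x)"
    unfolding beurling_mult_def by (subst infsum_add[OF s[OF a c] s[OF b c], symmetric])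
      (simp add: case_prod_unfold algebra_simps)
  show "beurling_mult \<omega> a (\<lambda>g. b g + c g) = (\<lambda>x. beurling_mult \<omega> a b x + beurling_mult \<omega> a c x)"
    unfolding beurling_mult_def by (subst infsum_add[OF s[OF a b] s[OF a c], symmetric])
      (simp add: case_prod_unfold algebra_simps)
  show "beurling_mult \<omega> (\<lambda>g. z * a g) b = (\<lambda>x. z * beurling_mult \<omega> a b x)"
    unfolding beurling_mult_def by (subst infsum_cmult_right'[symmetric])
      (simp add: case_prod_unfold mult.assoc)
  show "beurling_mult \<omega> a (\<lambda>g. z * b g) = (\<lambda>x. z * beurling_mult \<omega> a b x)"
    unfolding beurling_mult_def by (subst infsum_cmult_right'[symmetric])
      (simp add: case_prod_unfold mult_ac)
qed


section \<open>Pointwise virtual diagonals\<close>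

text \<open>
  The two conditions on a functional \<open>M\<close> on \<open>\<ell>\<^sup>\<infinity>(S \<times> S)\<close>.  Both families are indexed by \<open>(g, h)\<close>, but
  \<open>f\<close> takes its arguments in the opposite order.
\<close>

definition pointwise_diagonal ::
    "('s::monoid_mult \<Rightarrow> real) \<Rightarrow> 's \<Rightarrow> (('s \<times> 's \<Rightarrow> complex) \<Rightarrow> complex) \<Rightarrow> bool" where
  "pointwise_diagonal \<omega> k M \<longleftrightarrow>
    (\<forall>f :: 's \<times> 's \<Rightarrow> complex. bounded (range f) \<longrightarrow>
      M (\<lambda>(g, h). f (h * k, g) * weight_ratio \<omega> h k - f (h, k * g) * weight_ratio \<omega> k g) = 0) \<and>
    (\<forall>f :: 's \<Rightarrow> complex. bounded (range f) \<longrightarrow>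
      M (\<lambda>(g, h). f (g * h) * weight_ratio \<omega> g h) = f 1)"

end

theory Submission
  imports Defs "HOL-Analysis.Uniform_Limit"
begin

text \<open>
  Write \<open>\<A>\<close> for the Beurling algebra, \<open>\<delta>\<^sub>g\<close> for the point masses, \<open>\<Omega>\<close> for \<^const>\<open>weight_ratio\<close>, and
  \<open>\<pi> : \<A> \<otimes> \<A> \<rightarrow> \<A>\<close> for the product map, where \<open>\<otimes>\<close> is the projective tensor product.  Because
  \<open>\<omega> 1 = 1\<close>, the algebra has the unit \<open>\<delta>\<^sub>1\<close>.  A pointwise diagonal at \<open>k\<close> is an \<open>M\<close> in the bidual of
  \<open>\<A> \<otimes> \<A>\<close> with \<open>\<delta>\<^sub>k \<cdot> M = M \<cdot> \<delta>\<^sub>k\<close> and \<open>\<pi>\<^sup>*\<^sup>*(M) = \<delta>\<^sub>1\<close>, and the proof is Johnson's correspondence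
  between virtual diagonals and inner derivations, carried out for a single element.

  From amenability to a diagonal.  The derivation \<open>a \<mapsto> a \<cdot> (\<delta>\<^sub>1 \<otimes> \<delta>\<^sub>1) - (\<delta>\<^sub>1 \<otimes> \<delta>\<^sub>1) \<cdot> a\<close> takes values in
  \<open>(ker \<pi>)\<^sup>*\<^sup>*\<close>.  If \<open>N\<close> in that space implements it at \<open>\<delta>\<^sub>k\<close>, then \<open>M = \<delta>\<^sub>1 \<otimes> \<delta>\<^sub>1 - N\<close> is a diagonal at
  \<open>k\<close>.  The bimodule needed is therefore \<open>(ker \<pi>)\<^sup>*\<close>, the quotient of \<open>\<ell>\<^sup>\<infinity>(S \<times> S)\<close> by the range of
  \<open>\<pi>\<^sup>*\<close>.  That range is complemented: \<open>f\<close> is recovered from \<open>\<pi>\<^sup>* f\<close> by restricting to the pairs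
  \<open>(g, 1)\<close>, so \<open>P F = F - \<pi>\<^sup>*(F(\<cdot>, 1))\<close> is a bounded projection with kernel the range of \<open>\<pi>\<^sup>*\<close>.  As
  this range is a submodule, \<open>P (a \<cdot> P F) = P (a \<cdot> F)\<close>, and hence \<open>P (a \<cdot> F)\<close> and \<open>P (F \<cdot> a)\<close> are again
  bimodule actions on the whole of \<open>\<ell>\<^sup>\<infinity>(S \<times> S)\<close>.  With these actions no quotient has to be formed, and
  the bimodule lives on functions on \<open>S \<times> S\<close> (lemmas \<open>kernel_bimodule_banach\<close>,
  \<open>derivation_commutator\<close> and \<open>pointwise_amenable_at_imp_pointwise_diagonal\<close>).

  From a diagonal to amenability.  If \<open>M\<close> were \<open>\<Sum> a\<^sub>i \<otimes> b\<^sub>i\<close>, the functional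
  \<open>\<phi>\<^sub>0 = \<Sum> a\<^sub>i \<cdot> D b\<^sub>i\<close> would satisfy \<open>\<delta>\<^sub>k \<cdot> \<phi>\<^sub>0 - \<phi>\<^sub>0 \<cdot> \<delta>\<^sub>k = \<delta>\<^sub>1 \<cdot> D \<delta>\<^sub>k\<close>.  For general \<open>M\<close> one
  puts \<open>\<phi>\<^sub>0(x) = M((g, h) \<mapsto> D \<delta>\<^sub>h (x \<cdot> \<delta>\<^sub>g))\<close> and the same computation goes through.  Since the module
  need not be unital, the part \<open>D \<delta>\<^sub>k - \<delta>\<^sub>1 \<cdot> D \<delta>\<^sub>k\<close> is still missing; it is implemented by
  \<open>\<delta>\<^sub>1 \<cdot> D \<delta>\<^sub>1 - D \<delta>\<^sub>1\<close>, because \<open>\<delta>\<^sub>1 \<cdot> D \<delta>\<^sub>1 \<cdot> \<delta>\<^sub>1 = 0\<close>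
  (lemma \<open>pointwise_diagonal_imp_pointwise_amenable_at\<close>).
\<close>

section \<open>Bounded families and the duality of \<open>\<ell>\<^sup>1\<close> and \<open>\<ell>\<^sup>\<infinity>\<close>\<close>

lemma bounded_range_iff: "bounded (range f) \<longleftrightarrow> (\<exists>C\<ge>0. \<forall>x. cmod (f x) \<le> C)"
  unfolding bounded_iff
proof safe
  fix C assume "\<forall>x\<in>range f. cmod x \<le> C"
  then show "\<exists>C\<ge>0. \<forall>x. cmod (f x) \<le> C"
    by (intro exI[of _ "max 0 C"]) (auto simp: le_max_iff_disj)
qed blast

lemma bounded_range_compose: "bounded (range f) \<Longrightarrow> bounded (range (\<lambda>x. f (t x)))"
  by (erule bounded_subset) auto

lemma bounded_range_add:
  fixes f g :: "'i \<Rightarrow> complex"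
  assumes "bounded (range f)" "bounded (range g)"
  shows "bounded (range (\<lambda>x. f x + g x))"
proof -
  obtain C D where C: "C \<ge> 0" "\<And>x. cmod (f x) \<le> C" and D: "D \<ge> 0" "\<And>x. cmod (g x) \<le> D"
    using assms unfolding bounded_range_iff by blast
  show ?thesis
    unfolding bounded_range_iff
    using C D by (intro exI[of _ "C + D"]) (auto intro!: norm_triangle_le add_mono)
qed

lemma bounded_range_mult:
  fixes f g :: "'i \<Rightarrow> complex"
  assumes "bounded (range f)" "bounded (range g)"
  shows "bounded (range (\<lambda>x. f x * g x))"
proof -
  obtain C D where C: "C \<ge> 0" "\<And>x. cmod (f x) \<le> C" and D: "D \<ge> 0" "\<And>x. cmod (g x) \<le> D"
    using assms unfolding bounded_range_iff by blast
  show ?thesis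
    unfolding bounded_range_iff norm_mult
    using C D by (intro exI[of _ "C * D"]) (auto intro!: mult_mono)
qed

lemma bounded_range_cmult:
  fixes f :: "'i \<Rightarrow> complex"
  shows "bounded (range f) \<Longrightarrow> bounded (range (\<lambda>x. c * f x))"
  by (rule bounded_range_mult) auto

lemma bounded_range_diff:
  fixes f g :: "'i \<Rightarrow> complex"
  assumes "bounded (range f)" "bounded (range g)"
  shows "bounded (range (\<lambda>x. f x - g x))"
  using bounded_range_add[OF assms(1) bounded_range_cmult[OF assms(2), of "-1"]] by simp

lemma bounded_range_weight_ratio: "weight \<omega> \<Longrightarrow> bounded (range (\<lambda>x. weight_ratio \<omega> (s x) (t x)))"
  unfolding bounded_range_iff by (rule exI[of _ 1]) (simp add: weight_ratio_norm)

definition pairing :: "('s \<Rightarrow> complex) \<Rightarrow> ('s \<Rightarrow> complex) \<Rightarrow> complex" where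
  "pairing a f = (\<Sum>\<^sub>\<infinity>x. a x * f x)"

lemma pairing_abs_summable:
  fixes a f :: "'s \<Rightarrow> complex"
  assumes a: "a abs_summable_on UNIV" and f: "bounded (range f)"
  shows "(\<lambda>x. a x * f x) abs_summable_on UNIV"
proof -
  obtain C where C: "C \<ge> 0" "\<And>x. cmod (f x) \<le> C" using f unfolding bounded_range_iff by blast
  have "(\<lambda>x. cmod (a x) * C) summable_on UNIV"
    using a by (rule summable_on_cmult_left)
  then show ?thesis
    by (rule abs_summable_on_comparison_test') (auto simp: norm_mult intro!: mult_left_mono C)
qed

lemma pairing_summable:
  fixes a f :: "'s \<Rightarrow> complex"
  shows "a abs_summable_on UNIV \<Longrightarrow> bounded (range f) \<Longrightarrow> (\<lambda>x. a x * f x) summable_on UNIV"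
  by (rule abs_summable_summable, rule pairing_abs_summable)

lemma pairing_norm_le:
  assumes a: "a abs_summable_on UNIV" and f: "\<And>x. cmod (f x) \<le> C"
  shows "cmod (pairing a f) \<le> C * (\<Sum>\<^sub>\<infinity>x. cmod (a x))"
proof -
  have "0 \<le> C" using f[of undefined] norm_ge_zero by (rule order_trans[rotated])
  with f have bf: "bounded (range f)" unfolding bounded_range_iff by blast
  have "cmod (pairing a f) \<le> (\<Sum>\<^sub>\<infinity>x. cmod (a x * f x))"
    unfolding pairing_def by (rule norm_infsum_bound[OF pairing_abs_summable[OF a bf]])
  also have "\<dots> \<le> (\<Sum>\<^sub>\<infinity>x. C * cmod (a x))"
    by (rule infsum_mono[OF pairing_abs_summable[OF a bf] summable_on_cmult_right[OF a]])
      (use f in \<open>auto simp: norm_mult mult.commute[of C] intro!: mult_left_mono\<close>)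
  also have "\<dots> = C * (\<Sum>\<^sub>\<infinity>x. cmod (a x))" by (rule infsum_cmult_right')
  finally show ?thesis .
qed

lemma bounded_range_pairing:
  assumes a: "a abs_summable_on UNIV" and F: "bounded (range (\<lambda>p. F (fst p) (snd p)))"
  shows "bounded (range (\<lambda>i. pairing a (F i)))"
proof -
  obtain C where "C \<ge> 0" "\<And>i k. cmod (F i k) \<le> C" using F unfolding bounded_range_iff by auto
  then show ?thesis
    unfolding bounded_range_iff
    by (intro exI[of _ "C * (\<Sum>\<^sub>\<infinity>x. cmod (a x))"]) (auto intro!: pairing_norm_le[OF a] mult_nonneg_nonneg infsum_nonneg)
qed

lemma pairing_add_left:
  "\<lbrakk>a abs_summable_on UNIV; b abs_summable_on UNIV; bounded (range f)\<rbrakk>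
   \<Longrightarrow> pairing (\<lambda>x. a x + b x) f = pairing a f + pairing b f"
  unfolding pairing_def distrib_right by (intro infsum_add pairing_summable)

lemma pairing_add_right:
  "\<lbrakk>a abs_summable_on UNIV; bounded (range f); bounded (range g)\<rbrakk>
   \<Longrightarrow> pairing a (\<lambda>x. f x + g x) = pairing a f + pairing a g"
  unfolding pairing_def distrib_left by (intro infsum_add pairing_summable)

lemma pairing_cmult_left: "pairing (\<lambda>x. c * a x) f = c * pairing a f"
  unfolding pairing_def mult.assoc by (rule infsum_cmult_right')

lemma pairing_cmult_right: "pairing a (\<lambda>x. c * f x) = c * pairing a f"
  unfolding pairing_def mult.left_commute[of _ c] by (rule infsum_cmult_right')

lemma pairing_diff_right:
  assumes "a abs_summable_on UNIV" "bounded (range f)" "bounded (range g)"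
  shows "pairing a (\<lambda>x. f x - g x) = pairing a f - pairing a g"
  using pairing_add_right[OF assms(1,2) bounded_range_cmult[OF assms(3), of "-1"]]
  by (simp add: pairing_cmult_right[of a "-1", simplified])

lemma pairing_point_mass: "pairing (point_mass k) f = f k"
proof -
  have "pairing (point_mass k) f = (\<Sum>\<^sub>\<infinity>x\<in>{k}. f x)"
    unfolding pairing_def by (rule infsum_cong_neutral) (auto simp: point_mass_def)
  then show ?thesis by simp
qed

lemma point_mass_abs_summable: "point_mass k abs_summable_on UNIV"
proof -
  have "(\<lambda>x. cmod (point_mass k x)) summable_on UNIV \<longleftrightarrow> (\<lambda>x. 1 :: real) summable_on {k}"
    by (rule summable_on_cong_neutral) (auto simp: point_mass_def)
  then show ?thesis by simp
qed

lemma point_mass_norm: "(\<Sum>\<^sub>\<infinity>x. cmod (point_mass k x)) = 1"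
proof -
  have "(\<Sum>\<^sub>\<infinity>x. cmod (point_mass k x)) = (\<Sum>\<^sub>\<infinity>x\<in>{k}. 1)"
    by (rule infsum_cong_neutral) (auto simp: point_mass_def)
  then show ?thesis by simp
qed

lemma pairing_tensor_summable:
  fixes a :: "'i \<Rightarrow> complex" and b :: "'j \<Rightarrow> complex" and F :: "'i \<Rightarrow> 'j \<Rightarrow> complex"
  assumes a: "a abs_summable_on UNIV" and b: "b abs_summable_on UNIV"
    and F: "bounded (range (\<lambda>p. F (fst p) (snd p)))"
  shows "(\<lambda>(k, l). a k * (b l * F k l)) abs_summable_on UNIV \<times> UNIV"
proof -
  obtain C where C: "C \<ge> 0" "\<And>k l. cmod (F k l) \<le> C"
    using F unfolding bounded_range_iff by auto
  have "(\<lambda>(k, l). a k * (b l * complex_of_real C)) abs_summable_on UNIV \<times> UNIV"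
    using a b C(1)
    by (subst abs_summable_on_Sigma_iff)
      (auto simp: norm_mult infsum_cmult_right' infsum_cmult_left' infsum_nonneg
        intro!: summable_on_cmult_right summable_on_cmult_left)
  then show ?thesis
    by (rule abs_summable_on_comparison_test)
      (use C in \<open>auto simp: norm_mult intro!: mult_left_mono\<close>)
qed

lemma pairing_swap:
  assumes a: "a abs_summable_on UNIV" and b: "b abs_summable_on UNIV"
    and F: "bounded (range (\<lambda>p. F (fst p) (snd p)))"
  shows "pairing a (\<lambda>k. pairing b (\<lambda>l. F k l)) = pairing b (\<lambda>l. pairing a (\<lambda>k. F k l))"
proof -
  have "pairing a (\<lambda>k. pairing b (\<lambda>l. F k l)) = (\<Sum>\<^sub>\<infinity>k. \<Sum>\<^sub>\<infinity>l. a k * (b l * F k l))"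
    by (simp add: pairing_def infsum_cmult_right')
  also have "\<dots> = (\<Sum>\<^sub>\<infinity>l. \<Sum>\<^sub>\<infinity>k. a k * (b l * F k l))"
    by (rule infsum_swap_banach[OF abs_summable_summable[OF pairing_tensor_summable[OF a b F]]])
  also have "\<dots> = pairing b (\<lambda>l. pairing a (\<lambda>k. F k l))"
    by (simp add: pairing_def infsum_cmult_right'[symmetric] mult.left_commute)
  finally show ?thesis .
qed

text \<open>Turns the module identities below, which involve the product of the algebra,
  into identities between iterated pairings of bounded families.  The double sum converges
  absolutely and is grouped along the fibres of \<open>(g, h) \<mapsto> g * h\<close>.\<close>

lemma pairing_beurling_mult:
  assumes w: "weight \<omega>" and a: "a abs_summable_on UNIV" and b: "b abs_summable_on UNIV"
    and f: "bounded (range f)"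
  shows "pairing (beurling_mult \<omega> a b) f = pairing a (\<lambda>k. pairing b (\<lambda>l. weight_ratio \<omega> k l * f (k * l)))"
proof -
  let ?F = "\<lambda>x. {(g, h). g * h = x}"
  let ?t = "\<lambda>p. a (fst p) * (b (snd p) * (weight_ratio \<omega> (fst p) (snd p) * f (fst p * snd p)))"
  have bij: "bij_betw snd (Sigma UNIV ?F) UNIV"
    by (rule bij_betwI[where g = "\<lambda>(g, h). (g * h, (g, h))"]) auto
  have t: "?t summable_on UNIV"
    using abs_summable_summable[OF pairing_tensor_summable[OF a b,
      of "\<lambda>k l. weight_ratio \<omega> k l * f (k * l)"]]
      bounded_range_mult[OF bounded_range_weight_ratio[OF w, of fst snd] bounded_range_compose[OF f, of "\<lambda>p. fst p * snd p"]]
    by (simp add: case_prod_unfold)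
  then have S: "(\<lambda>p. ?t (snd p)) summable_on Sigma UNIV ?F"
    using summable_on_reindex_bij_betw[OF bij, of ?t] by simp
  have fib: "beurling_mult \<omega> a b x * f x = (\<Sum>\<^sub>\<infinity>p\<in>?F x. ?t p)" for x
    unfolding beurling_mult_def
    by (subst infsum_cmult_left'[symmetric], rule infsum_cong) auto
  have "pairing (beurling_mult \<omega> a b) f = (\<Sum>\<^sub>\<infinity>x. \<Sum>\<^sub>\<infinity>p\<in>?F x. ?t p)"
    unfolding pairing_def fib ..
  also have "\<dots> = (\<Sum>\<^sub>\<infinity>p\<in>Sigma UNIV ?F. ?t (snd p))"
    using infsum_Sigma'_banach[of "\<lambda>x p. ?t p" UNIV ?F] S by (simp add: case_prod_unfold)
  also have "\<dots> = (\<Sum>\<^sub>\<infinity>p\<in>UNIV \<times> UNIV. ?t p)"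
    using infsum_reindex_bij_betw[OF bij, of ?t] by simp
  also have "\<dots> = (\<Sum>\<^sub>\<infinity>k. \<Sum>\<^sub>\<infinity>l. ?t (k, l))"
    by (rule infsum_Sigma_banach[symmetric]) (use t in simp)
  also have "\<dots> = pairing a (\<lambda>k. pairing b (\<lambda>l. weight_ratio \<omega> k l * f (k * l)))"
    by (simp add: pairing_def infsum_cmult_right')
  finally show ?thesis .
qed

text \<open>Both sides are \<open>\<omega> (k * l * m) / (\<omega> k * \<omega> l * \<omega> m)\<close>.  This identity is what makes
  \<^const>\<open>beurling_mult\<close> associative.\<close>

lemma weight_ratio_cocycle:
  assumes "weight \<omega>"
  shows "weight_ratio \<omega> k l * weight_ratio \<omega> (k * l) m = weight_ratio \<omega> k (l * m) * weight_ratio \<omega> l m"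
proof -
  have "\<omega> g \<noteq> 0" for g using assms unfolding weight_def by (metis not_one_le_zero)
  then show ?thesis by (simp add: weight_ratio_def field_simps mult.assoc)
qed

lemma weight_ratio_one:
  fixes \<omega> :: "'s::monoid_mult \<Rightarrow> real"
  assumes "weight \<omega>" "\<omega> 1 = 1"
  shows "weight_ratio \<omega> 1 g = 1" "weight_ratio \<omega> g 1 = 1"
proof -
  have "\<omega> g \<noteq> 0" using assms unfolding weight_def by (metis not_one_le_zero)
  then show "weight_ratio \<omega> 1 g = 1" "weight_ratio \<omega> g 1 = 1"
    using assms by (simp_all add: weight_ratio_def)
qed

section \<open>Dual spaces and dual bimodules\<close>

lemma dual_space_bound:
  "\<phi> \<in> carrier (dual_space V) \<Longrightarrow> \<exists>C. \<forall>x\<in>carrier V. cmod (\<phi> x) \<le> C * vnorm V x"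
  by (simp add: dual_space_def)

lemma dual_space_add:
  "\<lbrakk>\<phi> \<in> carrier (dual_space V); x \<in> carrier V; y \<in> carrier V\<rbrakk> \<Longrightarrow> \<phi> (x \<oplus>\<^bsub>V\<^esub> y) = \<phi> x + \<phi> y"
  by (simp add: dual_space_def)

lemma dual_space_smult:
  "\<lbrakk>\<phi> \<in> carrier (dual_space V); x \<in> carrier V\<rbrakk> \<Longrightarrow> \<phi> (c \<odot>\<^bsub>V\<^esub> x) = c * \<phi> x"
  by (simp add: dual_space_def)

lemma (in complex_banach_space) dual_linear_combination:
  assumes \<phi>: "\<phi> \<in> carrier (dual_space V)" and \<psi>: "\<psi> \<in> carrier (dual_space V)"
  shows "(\<lambda>x\<in>carrier V. c * \<phi> x + d * \<psi> x) \<in> carrier (dual_space V)"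
proof -
  obtain B B' where B: "\<And>x. x \<in> carrier V \<Longrightarrow> cmod (\<phi> x) \<le> B * vnorm V x"
    and B': "\<And>x. x \<in> carrier V \<Longrightarrow> cmod (\<psi> x) \<le> B' * vnorm V x"
    using dual_space_bound[OF \<phi>] dual_space_bound[OF \<psi>] by blast
  have "cmod (c * \<phi> x + d * \<psi> x) \<le> (cmod c * B + cmod d * B') * vnorm V x" if "x \<in> carrier V" for x
  proof -
    have "cmod (c * \<phi> x + d * \<psi> x) \<le> cmod c * (B * vnorm V x) + cmod d * (B' * vnorm V x)"
      by (rule norm_triangle_le) (use B B' that in \<open>auto simp: norm_mult intro!: add_mono mult_left_mono\<close>)
    then show ?thesis by (simp add: algebra_simps)
  qed
  then have "\<exists>C. \<forall>x\<in>carrier V. cmod (c * \<phi> x + d * \<psi> x) \<le> C * vnorm V x" by blast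
  with \<phi> \<psi> show ?thesis
    by (auto simp: dual_space_def ring_of_type_algebra_def algebra_simps)
qed

lemma (in complex_banach_space) dual_abelian_group: "abelian_group (dual_space V)"
proof (rule abelian_groupI)
  show zero: "\<zero>\<^bsub>dual_space V\<^esub> \<in> carrier (dual_space V)"
    by (auto simp: dual_space_def ring_of_type_algebra_def intro!: exI[of _ 0])
  fix \<phi> \<psi> \<theta>
  assume \<phi>: "\<phi> \<in> carrier (dual_space V)"
  show "\<exists>\<psi>\<in>carrier (dual_space V). \<psi> \<oplus>\<^bsub>dual_space V\<^esub> \<phi> = \<zero>\<^bsub>dual_space V\<^esub>"
    by (rule bexI[OF _ dual_linear_combination[OF \<phi> \<phi>, of "-1" 0]])
      (auto simp: dual_space_def)
  show "\<zero>\<^bsub>dual_space V\<^esub> \<oplus>\<^bsub>dual_space V\<^esub> \<phi> = \<phi>"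
    using \<phi> by (auto simp: dual_space_def fun_eq_iff restrict_def extensional_def)
  assume \<psi>: "\<psi> \<in> carrier (dual_space V)"
  show "\<phi> \<oplus>\<^bsub>dual_space V\<^esub> \<psi> \<in> carrier (dual_space V)"
    using dual_linear_combination[OF \<phi> \<psi>, of 1 1] by (simp add: dual_space_def)
  show "\<phi> \<oplus>\<^bsub>dual_space V\<^esub> \<psi> = \<psi> \<oplus>\<^bsub>dual_space V\<^esub> \<phi>"
    by (simp add: dual_space_def add.commute)
  show "(\<phi> \<oplus>\<^bsub>dual_space V\<^esub> \<psi>) \<oplus>\<^bsub>dual_space V\<^esub> \<theta> = \<phi> \<oplus>\<^bsub>dual_space V\<^esub> (\<psi> \<oplus>\<^bsub>dual_space V\<^esub> \<theta>)"
    by (auto simp: dual_space_def fun_eq_iff restrict_def)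
qed

lemma (in complex_banach_space) dual_minus:
  assumes \<phi>: "\<phi> \<in> carrier (dual_space V)" and \<psi>: "\<psi> \<in> carrier (dual_space V)"
  shows "\<phi> \<ominus>\<^bsub>dual_space V\<^esub> \<psi> = (\<lambda>x\<in>carrier V. \<phi> x - \<psi> x)"
proof -
  interpret D: abelian_group "dual_space V" by (rule dual_abelian_group)
  have "\<ominus>\<^bsub>dual_space V\<^esub> \<psi> = (\<lambda>x\<in>carrier V. - \<psi> x)"
  proof (rule D.minus_equality)
    show "(\<lambda>x\<in>carrier V. - \<psi> x) \<in> carrier (dual_space V)"
      using dual_linear_combination[OF \<psi> \<psi>, of "-1" 0] by simp
    show "(\<lambda>x\<in>carrier V. - \<psi> x) \<oplus>\<^bsub>dual_space V\<^esub> \<psi> = \<zero>\<^bsub>dual_space V\<^esub>"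
      by (auto simp: dual_space_def)
  qed (rule \<psi>)
  then show ?thesis by (auto simp: a_minus_def dual_space_def)
qed

text \<open>The norm of the dual is a supremum over the unit ball, so a nonzero \<open>x\<close> is scaled to norm one.\<close>

lemma (in complex_banach_space) dual_norm_bound:
  assumes \<phi>: "\<phi> \<in> carrier (dual_space V)" and x: "x \<in> carrier V"
  shows "cmod (\<phi> x) \<le> vnorm (dual_space V) \<phi> * vnorm V x"
proof -
  obtain C where C: "\<And>x. x \<in> carrier V \<Longrightarrow> cmod (\<phi> x) \<le> C * vnorm V x"
    using dual_space_bound[OF \<phi>] by blast
  show ?thesis
  proof (cases "vnorm V x = 0")
    case True
    with C[OF x] show ?thesis by simp
  next
    case False
    with vnorm_nonneg[OF x] have pos: "0 < vnorm V x" by simp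
    let ?y = "complex_of_real (1 / vnorm V x) \<odot>\<^bsub>V\<^esub> x"
    have y: "?y \<in> carrier V" using x by (intro smult_closed) (auto simp: ring_of_type_algebra_def)
    have ny: "vnorm V ?y = 1" using pos x by (simp add: vnorm_smult norm_divide)
    have "bdd_above ((\<lambda>x. cmod (\<phi> x)) ` {x \<in> carrier V. vnorm V x \<le> 1})"
    proof (rule bdd_aboveI2[where M = "\<bar>C\<bar>"])
      fix z assume z: "z \<in> {x \<in> carrier V. vnorm V x \<le> 1}"
      then have "C * vnorm V z \<le> \<bar>C\<bar> * 1" using vnorm_nonneg[of z] by (intro mult_mono) auto
      with C[of z] z show "cmod (\<phi> z) \<le> \<bar>C\<bar>" by auto
    qed
    then have "cmod (\<phi> ?y) \<le> vnorm (dual_space V) \<phi>"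
      unfolding dual_space_def normed_space.simps
      by (rule cSUP_upper[rotated]) (use y ny in auto)
    moreover have "cmod (\<phi> ?y) = cmod (\<phi> x) / vnorm V x"
      using pos dual_space_smult[OF \<phi> x] by (simp add: norm_mult norm_divide)
    ultimately show ?thesis using pos by (simp add: pos_divide_le_eq)
  qed
qed

lemma dual_bimodule_simps:
  "carrier (dual_bimodule E) = carrier (dual_space E)"
  "add (dual_bimodule E) = (\<lambda>\<phi> \<psi>. \<lambda>x\<in>carrier E. \<phi> x + \<psi> x)"
  "module.smult (dual_bimodule E) = (\<lambda>c \<phi>. \<lambda>x\<in>carrier E. c * \<phi> x)"
  "vnorm (dual_bimodule E) = vnorm (dual_space E)"
  "lact (dual_bimodule E) = (\<lambda>a \<phi>. \<lambda>x\<in>carrier E. \<phi> (ract E x a))"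
  "ract (dual_bimodule E) = (\<lambda>\<phi> a. \<lambda>x\<in>carrier E. \<phi> (lact E a x))"
  "\<phi> \<ominus>\<^bsub>dual_bimodule E\<^esub> \<psi> = \<phi> \<ominus>\<^bsub>dual_space E\<^esub> \<psi>"
  by (simp_all add: dual_bimodule_def dual_space_def normed_space.defs bimodule.defs a_minus_def a_inv_def m_inv_def)

lemma (in banach_bimodule) dual_lact_closed:
  assumes \<phi>: "\<phi> \<in> carrier (dual_space E)" and a: "a \<in> carrier A"
  shows "(\<lambda>x\<in>carrier E. \<phi> (ract E x a)) \<in> carrier (dual_space E)"
proof -
  obtain B C where B: "\<And>x. x \<in> carrier E \<Longrightarrow> cmod (\<phi> x) \<le> B * vnorm E x"
    and C: "\<And>x. x \<in> carrier E \<Longrightarrow> vnorm E (ract E x a) \<le> C * vnorm A a * vnorm E x"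
    using dual_space_bound[OF \<phi>] ract_bounded a by blast
  have "cmod (\<phi> (ract E x a)) \<le> (\<bar>B\<bar> * (C * vnorm A a)) * vnorm E x" if x: "x \<in> carrier E" for x
  proof -
    have y: "ract E x a \<in> carrier E" by (rule ract_closed[OF a x])
    have "cmod (\<phi> (ract E x a)) \<le> B * vnorm E (ract E x a)" by (rule B[OF y])
    also have "\<dots> \<le> \<bar>B\<bar> * (C * vnorm A a * vnorm E x)"
      by (intro mult_mono C[OF x] vnorm_nonneg[OF y]) auto
    finally show ?thesis by (simp add: mult.assoc)
  qed
  then have "\<exists>C. \<forall>x\<in>carrier E. cmod (\<phi> (ract E x a)) \<le> C * vnorm E x" by blast
  then show ?thesis
    using smult_closed
    by (simp add: dual_space_def ring_of_type_algebra_def a ract_add_left ract_smult_left ract_closed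
        dual_space_add[OF \<phi>] dual_space_smult[OF \<phi>])
qed

lemma (in banach_bimodule) dual_ract_closed:
  assumes \<phi>: "\<phi> \<in> carrier (dual_space E)" and a: "a \<in> carrier A"
  shows "(\<lambda>x\<in>carrier E. \<phi> (lact E a x)) \<in> carrier (dual_space E)"
proof -
  obtain B C where B: "\<And>x. x \<in> carrier E \<Longrightarrow> cmod (\<phi> x) \<le> B * vnorm E x"
    and C: "\<And>x. x \<in> carrier E \<Longrightarrow> vnorm E (lact E a x) \<le> C * vnorm A a * vnorm E x"
    using dual_space_bound[OF \<phi>] lact_bounded a by blast
  have "cmod (\<phi> (lact E a x)) \<le> (\<bar>B\<bar> * (C * vnorm A a)) * vnorm E x" if x: "x \<in> carrier E" for x
  proof -
    have y: "lact E a x \<in> carrier E" by (rule lact_closed[OF a x])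
    have "cmod (\<phi> (lact E a x)) \<le> B * vnorm E (lact E a x)" by (rule B[OF y])
    also have "\<dots> \<le> \<bar>B\<bar> * (C * vnorm A a * vnorm E x)"
      by (intro mult_mono C[OF x] vnorm_nonneg[OF y]) auto
    finally show ?thesis by (simp add: mult.assoc)
  qed
  then have "\<exists>C. \<forall>x\<in>carrier E. cmod (\<phi> (lact E a x)) \<le> C * vnorm E x" by blast
  then show ?thesis
    using smult_closed
    by (simp add: dual_space_def ring_of_type_algebra_def a lact_add_right lact_smult_right lact_closed
        dual_space_add[OF \<phi>] dual_space_smult[OF \<phi>])
qed

section \<open>Bounded functions as a Banach space\<close>

lemma sup_norm_ge:
  fixes f :: "'i \<Rightarrow> complex"
  assumes "bounded (range f)"
  shows "cmod (f i) \<le> (SUP i. cmod (f i))"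
proof -
  obtain C where "\<And>i. cmod (f i) \<le> C" using assms unfolding bounded_range_iff by blast
  then show ?thesis by (intro cSUP_upper bdd_aboveI2) auto
qed

lemma sup_norm_le:
  fixes f :: "'i \<Rightarrow> complex"
  shows "(\<And>i. cmod (f i) \<le> C) \<Longrightarrow> (SUP i. cmod (f i)) \<le> C"
  by (rule cSUP_least) auto

lemma sup_norm_nonneg:
  fixes f :: "'i \<Rightarrow> complex"
  assumes "bounded (range f)"
  shows "0 \<le> (SUP i. cmod (f i))"
  using sup_norm_ge[OF assms, of undefined] norm_ge_zero order_trans by blast

text \<open>Stated for every record that agrees with \<^const>\<open>linf_space\<close> on the Banach space fields, so that
  it also applies to bimodules built on that space.\<close>

lemma linf_banach_space:
  fixes V :: "('i \<Rightarrow> complex, 'm) normed_space_scheme"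
  assumes V: "carrier V = {f. bounded (range f)}" "zero V = (\<lambda>_. 0)"
    "add V = (\<lambda>f g i. f i + g i)" "module.smult V = (\<lambda>c f i. c * f i)"
    "vnorm V = (\<lambda>f. SUP i. cmod (f i))"
  shows "complex_banach_space V"
proof -
  have grp: "abelian_group V"
  proof (rule abelian_groupI)
    fix f assume "f \<in> carrier V"
    then show "\<exists>g\<in>carrier V. g \<oplus>\<^bsub>V\<^esub> f = \<zero>\<^bsub>V\<^esub>"
      using bounded_range_cmult[of f "-1"] by (intro bexI[of _ "\<lambda>i. - f i"]) (auto simp: V)
  qed (auto simp: V add_ac intro: bounded_range_add)
  then interpret G: abelian_group V .
  have "module (ring_of_type_algebra :: complex ring) V"
    by (rule moduleI[OF cring_from_type_algebra grp])
      (auto simp: V ring_of_type_algebra_def algebra_simps intro: bounded_range_cmult)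
  moreover have minus: "f \<ominus>\<^bsub>V\<^esub> g = (\<lambda>i. f i - g i)" if "f \<in> carrier V" "g \<in> carrier V" for f g
  proof -
    have "\<ominus>\<^bsub>V\<^esub> g = (\<lambda>i. - g i)"
      by (rule G.minus_equality)
        (use that bounded_range_cmult[of g "-1"] in \<open>auto simp: V\<close>)
    then show ?thesis by (simp add: a_minus_def V)
  qed
  moreover have "complex_banach_space_axioms V"
  proof
    fix f assume "f \<in> carrier V"
    then have f: "bounded (range f)" by (simp add: V)
    show "0 \<le> vnorm V f" using sup_norm_nonneg[OF f] by (simp add: V)
    show "vnorm V f = 0 \<longleftrightarrow> f = \<zero>\<^bsub>V\<^esub>"
      using sup_norm_ge[OF f] by (auto simp: V fun_eq_iff)
    show "vnorm V (c \<odot>\<^bsub>V\<^esub> f) = cmod c * vnorm V f" for c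
    proof (rule antisym)
      show "vnorm V (c \<odot>\<^bsub>V\<^esub> f) \<le> cmod c * vnorm V f"
        by (simp add: V norm_mult)
          (intro sup_norm_le[of "\<lambda>i. c * f i", unfolded norm_mult] mult_left_mono sup_norm_ge[OF f] norm_ge_zero)
      show "cmod c * vnorm V f \<le> vnorm V (c \<odot>\<^bsub>V\<^esub> f)"
      proof (cases "c = 0")
        case False
        have "(SUP i. cmod (f i)) \<le> (SUP i. cmod (c * f i)) / cmod c"
          by (rule sup_norm_le)
            (use False sup_norm_ge[OF bounded_range_cmult[OF f, of c]] in
              \<open>simp add: pos_le_divide_eq norm_mult mult.commute\<close>)
        with False show ?thesis by (simp add: V pos_le_divide_eq mult.commute)
      qed (simp add: V)
    qed
  next
    fix f g assume "f \<in> carrier V" "g \<in> carrier V"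
    then have fg: "bounded (range f)" "bounded (range g)" by (auto simp: V)
    show "vnorm V (f \<oplus>\<^bsub>V\<^esub> g) \<le> vnorm V f + vnorm V g"
      unfolding V by (intro sup_norm_le norm_triangle_le add_mono sup_norm_ge fg)
  next
    fix u :: "nat \<Rightarrow> 'i \<Rightarrow> complex"
    assume u: "\<And>n. u n \<in> carrier V"
      and C: "\<forall>\<epsilon>>0. \<exists>N. \<forall>m\<ge>N. \<forall>n\<ge>N. vnorm V (u m \<ominus>\<^bsub>V\<^esub> u n) < \<epsilon>"
    have bu: "bounded (range (u n))" for n using u[of n] by (simp add: V)
    have le: "dist (u m i) (u n i) \<le> vnorm V (u m \<ominus>\<^bsub>V\<^esub> u n)" for m n i
      using sup_norm_ge[OF bounded_range_diff[OF bu bu]] by (simp add: minus bu V dist_norm)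
    have "uniformly_convergent_on UNIV u"
      by (intro Cauchy_uniformly_convergent uniformly_Cauchy_onI)
        (use C le in \<open>meson le_less_trans\<close>)
    then obtain l where l: "uniform_limit UNIV u l sequentially"
      unfolding uniformly_convergent_on_def by blast
    obtain N where N: "\<And>i. dist (u N i) (l i) < 1"
      using l[unfolded uniform_limit_sequentially_iff, rule_format, of 1] by auto
    have "bounded (range (\<lambda>i. u N i - (u N i - l i)))"
      by (rule bounded_range_diff[OF bu], unfold bounded_range_iff, rule exI[of _ 1])
        (use N in \<open>auto simp: dist_norm less_imp_le\<close>)
    then have bl: "bounded (range l)" by simp
    have "(\<lambda>n. SUP i. cmod (u n i - l i)) \<longlonglongrightarrow> 0"
    proof (rule LIMSEQ_I)
      fix r :: real assume "0 < r"
      then obtain N where N: "\<And>n i. n \<ge> N \<Longrightarrow> dist (u n i) (l i) < r / 2"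
        using l[unfolded uniform_limit_sequentially_iff, rule_format, of "r / 2"] by auto
      have "(SUP i. cmod (u n i - l i)) \<le> r / 2" if "n \<ge> N" for n
        using N[OF that] by (intro sup_norm_le) (auto simp: dist_norm less_imp_le)
      then show "\<exists>no. \<forall>n\<ge>no. norm ((SUP i. cmod (u n i - l i)) - 0) < r"
        using \<open>0 < r\<close> sup_norm_nonneg[OF bounded_range_diff[OF bu bl]]
        by (intro exI[of _ N]) fastforce
    qed
    then show "\<exists>x\<in>carrier V. (\<lambda>n. vnorm V (u n \<ominus>\<^bsub>V\<^esub> x)) \<longlonglongrightarrow> 0"
      using u bl by (intro bexI[of _ l]) (auto simp: minus V)
  qed
  ultimately show ?thesis by (intro complex_banach_space.intro)
qed

section \<open>The bimodule of bounded functions on \<open>S \<times> S\<close>\<close>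

lemmas bounded_range_intros =
  bounded_range_add bounded_range_diff bounded_range_mult bounded_range_weight_ratio bounded_range_pairing

lemma weight_ratio_mult_norm_le: "weight \<omega> \<Longrightarrow> cmod z \<le> C \<Longrightarrow> cmod (weight_ratio \<omega> g h * z) \<le> C"
  using mult_mono[of "cmod (weight_ratio \<omega> g h)" 1 "cmod z" C] weight_ratio_norm[of \<omega> g h]
  by (simp add: norm_mult)

text \<open>The cocycle identity in right-nested form, in which the factors appear when one action is
  applied after another.\<close>

lemma weight_ratio_cocycle_mult:
  assumes "weight \<omega>"
  shows "weight_ratio \<omega> l m * (weight_ratio \<omega> k (l * m) * z) =
    weight_ratio \<omega> k l * (weight_ratio \<omega> (k * l) m * z)"
proof -
  have "weight_ratio \<omega> l m * (weight_ratio \<omega> k (l * m) * z) =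
      (weight_ratio \<omega> k (l * m) * weight_ratio \<omega> l m) * z"
    by simp
  also have "\<dots> = weight_ratio \<omega> k l * (weight_ratio \<omega> (k * l) m * z)"
    by (simp only: weight_ratio_cocycle[OF assms, symmetric] mult.assoc)
  finally show ?thesis .
qed

text \<open>The actions on \<open>\<ell>\<^sup>\<infinity>(S \<times> S)\<close> dual to \<open>a \<cdot> (b \<otimes> c) = a b \<otimes> c\<close> and \<open>(b \<otimes> c) \<cdot> a = b \<otimes> c a\<close>.  As
  sides change under duality, the left action multiplies the second variable from the right, and
  the right action multiplies the first variable from the left.\<close>

definition left_act ::
    "('s::semigroup_mult \<Rightarrow> real) \<Rightarrow> ('s \<Rightarrow> complex) \<Rightarrow> ('s \<times> 's \<Rightarrow> complex) \<Rightarrow> 's \<times> 's \<Rightarrow> complex" where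
  "left_act \<omega> a F = (\<lambda>p. pairing a (\<lambda>k. weight_ratio \<omega> (snd p) k * F (fst p, snd p * k)))"

definition right_act ::
    "('s::semigroup_mult \<Rightarrow> real) \<Rightarrow> ('s \<times> 's \<Rightarrow> complex) \<Rightarrow> ('s \<Rightarrow> complex) \<Rightarrow> 's \<times> 's \<Rightarrow> complex" where
  "right_act \<omega> F a = (\<lambda>p. pairing a (\<lambda>k. weight_ratio \<omega> k (fst p) * F (k * fst p, snd p)))"

text \<open>The adjoint \<open>\<pi>\<^sup>*\<close> of the product map \<open>\<pi> : \<A> \<otimes> \<A> \<rightarrow> \<A>\<close>.\<close>

definition mult_adjoint ::
    "('s::semigroup_mult \<Rightarrow> real) \<Rightarrow> ('s \<Rightarrow> complex) \<Rightarrow> 's \<times> 's \<Rightarrow> complex" where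
  "mult_adjoint \<omega> f = (\<lambda>p. weight_ratio \<omega> (fst p) (snd p) * f (fst p * snd p))"

text \<open>When \<open>\<omega> 1 = 1\<close>, this is the projection of \<open>\<ell>\<^sup>\<infinity>(S \<times> S)\<close> along the range of \<open>\<pi>\<^sup>*\<close> onto the functions that vanish on
  \<open>S \<times> {1}\<close>.  Its range represents \<open>(ker \<pi>)\<^sup>*\<close>.\<close>

definition kernel_proj ::
    "('s::monoid_mult \<Rightarrow> real) \<Rightarrow> ('s \<times> 's \<Rightarrow> complex) \<Rightarrow> 's \<times> 's \<Rightarrow> complex" where
  "kernel_proj \<omega> F = (\<lambda>p. F p - mult_adjoint \<omega> (\<lambda>g. F (g, 1)) p)"

lemma left_act_norm_le:
  "\<lbrakk>weight \<omega>; a abs_summable_on UNIV; \<And>p. cmod (F p) \<le> C\<rbrakk>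
   \<Longrightarrow> cmod (left_act \<omega> a F p) \<le> C * (\<Sum>\<^sub>\<infinity>x. cmod (a x))"
  unfolding left_act_def by (intro pairing_norm_le weight_ratio_mult_norm_le)

lemma right_act_norm_le:
  "\<lbrakk>weight \<omega>; a abs_summable_on UNIV; \<And>p. cmod (F p) \<le> C\<rbrakk>
   \<Longrightarrow> cmod (right_act \<omega> F a p) \<le> C * (\<Sum>\<^sub>\<infinity>x. cmod (a x))"
  unfolding right_act_def by (intro pairing_norm_le weight_ratio_mult_norm_le)

lemma kernel_proj_norm_le:
  "\<lbrakk>weight \<omega>; \<And>p. cmod (F p) \<le> C\<rbrakk> \<Longrightarrow> cmod (kernel_proj \<omega> F p) \<le> 2 * C"
  unfolding kernel_proj_def mult_adjoint_def mult_2
  by (intro norm_triangle_le_diff add_mono weight_ratio_mult_norm_le)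

lemma bounded_range_left_act:
  assumes "weight \<omega>" "a abs_summable_on UNIV" "bounded (range F)"
  shows "bounded (range (left_act \<omega> a F))"
  unfolding left_act_def by (intro bounded_range_intros bounded_range_compose[OF assms(3)] assms)

lemma bounded_range_right_act:
  assumes "weight \<omega>" "a abs_summable_on UNIV" "bounded (range F)"
  shows "bounded (range (right_act \<omega> F a))"
  unfolding right_act_def by (intro bounded_range_intros bounded_range_compose[OF assms(3)] assms)

lemma bounded_range_mult_adjoint:
  assumes "weight \<omega>" "bounded (range f)"
  shows "bounded (range (mult_adjoint \<omega> f))"
  unfolding mult_adjoint_def by (intro bounded_range_intros bounded_range_compose[OF assms(2)] assms)

lemma bounded_range_kernel_proj:
  assumes "weight \<omega>" "bounded (range F)"
  shows "bounded (range (kernel_proj \<omega> F))"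
  unfolding kernel_proj_def
  by (intro bounded_range_diff bounded_range_mult_adjoint bounded_range_compose[OF assms(2)] assms)

lemma left_act_mult:
  assumes w: "weight \<omega>" and a: "a abs_summable_on UNIV" and b: "b abs_summable_on UNIV"
    and F: "bounded (range F)"
  shows "left_act \<omega> (beurling_mult \<omega> a b) F = left_act \<omega> a (left_act \<omega> b F)"
  unfolding left_act_def
  by (subst pairing_beurling_mult[OF w a b],
      intro bounded_range_intros w bounded_range_compose[OF F])
    (simp add: pairing_cmult_right[symmetric] weight_ratio_cocycle_mult[OF w] mult.assoc)

text \<open>In contrast to the left action, the two pairings come out in the opposite order and have to be
  interchanged.\<close>

lemma right_act_mult:
  assumes w: "weight \<omega>" and a: "a abs_summable_on UNIV" and b: "b abs_summable_on UNIV"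
    and F: "bounded (range F)"
  shows "right_act \<omega> F (beurling_mult \<omega> a b) = right_act \<omega> (right_act \<omega> F a) b"
proof
  fix p
  let ?t = "\<lambda>k l. weight_ratio \<omega> k l * (weight_ratio \<omega> (k * l) (fst p) * F (k * l * fst p, snd p))"
  have "right_act \<omega> F (beurling_mult \<omega> a b) p = pairing a (\<lambda>k. pairing b (?t k))"
    unfolding right_act_def
    by (rule pairing_beurling_mult[OF w a b])
      (intro bounded_range_intros w bounded_range_compose[OF F])
  also have "\<dots> = pairing b (\<lambda>l. pairing a (\<lambda>k. ?t k l))"
    by (rule pairing_swap[OF a b]) (intro bounded_range_intros w bounded_range_compose[OF F])
  also have "\<dots> = right_act \<omega> (right_act \<omega> F a) b p"
    unfolding right_act_def
    by (simp add: pairing_cmult_right[symmetric] weight_ratio_cocycle_mult[OF w, symmetric] mult.assoc)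
  finally show "right_act \<omega> F (beurling_mult \<omega> a b) p = right_act \<omega> (right_act \<omega> F a) b p" .
qed

lemma left_act_right_act:
  assumes w: "weight \<omega>" and a: "a abs_summable_on UNIV" and b: "b abs_summable_on UNIV"
    and F: "bounded (range F)"
  shows "left_act \<omega> a (right_act \<omega> F b) = right_act \<omega> (left_act \<omega> a F) b"
proof
  fix p
  let ?t = "\<lambda>k l. weight_ratio \<omega> (snd p) k * (weight_ratio \<omega> l (fst p) * F (l * fst p, snd p * k))"
  have "left_act \<omega> a (right_act \<omega> F b) p = pairing a (\<lambda>k. pairing b (?t k))"
    by (simp add: left_act_def right_act_def pairing_cmult_right)
  also have "\<dots> = pairing b (\<lambda>l. pairing a (\<lambda>k. ?t k l))"
    by (rule pairing_swap[OF a b]) (intro bounded_range_intros w bounded_range_compose[OF F])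
  also have "\<dots> = right_act \<omega> (left_act \<omega> a F) b p"
    by (simp add: left_act_def right_act_def pairing_cmult_right[symmetric] mult.left_commute)
  finally show "left_act \<omega> a (right_act \<omega> F b) p = right_act \<omega> (left_act \<omega> a F) b p" .
qed

text \<open>The range of \<open>\<pi>\<^sup>*\<close> is a submodule, since \<open>\<pi>\<close> is a bimodule homomorphism; the function under
  \<open>\<pi>\<^sup>*\<close> on the right-hand side is \<open>a \<cdot> f\<close> (below: \<open>f \<cdot> a\<close>) in the dual of \<open>\<A>\<close>.\<close>

lemma left_act_mult_adjoint:
  assumes w: "weight \<omega>"
  shows "left_act \<omega> a (mult_adjoint \<omega> f) =
    mult_adjoint \<omega> (\<lambda>g. pairing a (\<lambda>k. weight_ratio \<omega> g k * f (g * k)))"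
  by (simp add: left_act_def mult_adjoint_def pairing_cmult_right[symmetric]
      weight_ratio_cocycle_mult[OF w] mult.assoc)

lemma right_act_mult_adjoint:
  assumes w: "weight \<omega>"
  shows "right_act \<omega> (mult_adjoint \<omega> f) a =
    mult_adjoint \<omega> (\<lambda>g. pairing a (\<lambda>k. weight_ratio \<omega> k g * f (k * g)))"
  by (simp add: right_act_def mult_adjoint_def pairing_cmult_right[symmetric]
      weight_ratio_cocycle_mult[OF w] mult.assoc)

lemma kernel_proj_mult_adjoint:
  "weight \<omega> \<Longrightarrow> \<omega> 1 = 1 \<Longrightarrow> kernel_proj \<omega> (mult_adjoint \<omega> f) = (\<lambda>_. 0)"
  by (simp add: kernel_proj_def mult_adjoint_def weight_ratio_one)

lemma kernel_proj_add:
  "kernel_proj \<omega> (\<lambda>p. F p + G p) = (\<lambda>p. kernel_proj \<omega> F p + kernel_proj \<omega> G p)"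
  by (simp add: kernel_proj_def mult_adjoint_def algebra_simps)

lemma kernel_proj_diff:
  "kernel_proj \<omega> (\<lambda>p. F p - G p) = (\<lambda>p. kernel_proj \<omega> F p - kernel_proj \<omega> G p)"
  by (simp add: kernel_proj_def mult_adjoint_def algebra_simps)

lemma kernel_proj_cmult: "kernel_proj \<omega> (\<lambda>p. c * F p) = (\<lambda>p. c * kernel_proj \<omega> F p)"
  by (simp add: kernel_proj_def mult_adjoint_def algebra_simps)

text \<open>\<open>F\<close> and its projection differ by an element of the range of \<open>\<pi>\<^sup>*\<close>; the action keeps that range
  invariant and the outer projection kills it.  This is what makes the projected actions
  multiplicative.\<close>

lemma kernel_proj_left_act:
  assumes w: "weight \<omega>" "\<omega> 1 = 1" and a: "a abs_summable_on UNIV" and F: "bounded (range F)"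
  shows "kernel_proj \<omega> (left_act \<omega> a (kernel_proj \<omega> F)) = kernel_proj \<omega> (left_act \<omega> a F)"
proof -
  let ?f = "\<lambda>g. F (g, 1)"
  have "left_act \<omega> a (kernel_proj \<omega> F) = (\<lambda>p. left_act \<omega> a F p - left_act \<omega> a (mult_adjoint \<omega> ?f) p)"
    unfolding left_act_def kernel_proj_def right_diff_distrib
    by (rule ext, rule pairing_diff_right[OF a])
      (intro bounded_range_intros w bounded_range_compose[OF F]
        bounded_range_compose[OF bounded_range_mult_adjoint[OF w(1)]])+
  then show ?thesis
    by (simp add: kernel_proj_diff left_act_mult_adjoint kernel_proj_mult_adjoint w)
qed

lemma kernel_proj_right_act:
  assumes w: "weight \<omega>" "\<omega> 1 = 1" and a: "a abs_summable_on UNIV" and F: "bounded (range F)"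
  shows "kernel_proj \<omega> (right_act \<omega> (kernel_proj \<omega> F) a) = kernel_proj \<omega> (right_act \<omega> F a)"
proof -
  let ?f = "\<lambda>g. F (g, 1)"
  have "right_act \<omega> (kernel_proj \<omega> F) a = (\<lambda>p. right_act \<omega> F a p - right_act \<omega> (mult_adjoint \<omega> ?f) a p)"
    unfolding right_act_def kernel_proj_def right_diff_distrib
    by (rule ext, rule pairing_diff_right[OF a])
      (intro bounded_range_intros w bounded_range_compose[OF F]
        bounded_range_compose[OF bounded_range_mult_adjoint[OF w(1)]])+
  then show ?thesis
    by (simp add: kernel_proj_diff right_act_mult_adjoint kernel_proj_mult_adjoint w)
qed

text \<open>A model of \<open>(ker \<pi>)\<^sup>*\<close> that avoids quotients: all bounded functions, with the projected
  actions.  The range of \<open>\<pi>\<^sup>*\<close> is retained, but both actions annihilate it.\<close>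

definition kernel_bimodule ::
    "('s::monoid_mult \<Rightarrow> real) \<Rightarrow> ('s \<Rightarrow> complex, 's \<times> 's \<Rightarrow> complex) bimodule" where
  "kernel_bimodule \<omega> = normed_space.extend linf_space
    (bimodule.fields
      (\<lambda>a F. kernel_proj \<omega> (left_act \<omega> a F))
      (\<lambda>F a. kernel_proj \<omega> (right_act \<omega> F a)))"

lemma kernel_bimodule_simps:
  "carrier (kernel_bimodule \<omega>) = {F. bounded (range F)}"
  "zero (kernel_bimodule \<omega>) = (\<lambda>_. 0)"
  "add (kernel_bimodule \<omega>) = (\<lambda>F G p. F p + G p)"
  "module.smult (kernel_bimodule \<omega>) = (\<lambda>c F p. c * F p)"
  "vnorm (kernel_bimodule \<omega>) = (\<lambda>F. SUP p. cmod (F p))"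
  "lact (kernel_bimodule \<omega>) = (\<lambda>a F. kernel_proj \<omega> (left_act \<omega> a F))"
  "ract (kernel_bimodule \<omega>) = (\<lambda>F a. kernel_proj \<omega> (right_act \<omega> F a))"
  by (simp_all add: kernel_bimodule_def linf_space_def normed_space.defs bimodule.defs)

lemma beurling_algebra_simps:
  "carrier (beurling_algebra \<omega>) = {a. a abs_summable_on UNIV}"
  "mult (beurling_algebra \<omega>) = beurling_mult \<omega>"
  "add (beurling_algebra \<omega>) = (\<lambda>a b g. a g + b g)"
  "module.smult (beurling_algebra \<omega>) = (\<lambda>c a g. c * a g)"
  "vnorm (beurling_algebra \<omega>) = (\<lambda>a. \<Sum>\<^sub>\<infinity>g. cmod (a g))"
  by (simp_all add: beurling_algebra_def)

lemma left_act_add_algebra: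
  assumes "weight \<omega>" "a abs_summable_on UNIV" "b abs_summable_on UNIV" "bounded (range F)"
  shows "left_act \<omega> (\<lambda>g. a g + b g) F = (\<lambda>p. left_act \<omega> a F p + left_act \<omega> b F p)"
  unfolding left_act_def
  by (intro ext pairing_add_left bounded_range_intros bounded_range_compose[OF assms(4)] assms)

lemma left_act_add:
  assumes "weight \<omega>" "a abs_summable_on UNIV" "bounded (range F)" "bounded (range G)"
  shows "left_act \<omega> a (\<lambda>p. F p + G p) = (\<lambda>p. left_act \<omega> a F p + left_act \<omega> a G p)"
  unfolding left_act_def distrib_left
  by (intro ext pairing_add_right bounded_range_intros bounded_range_compose[OF assms(3)]
      bounded_range_compose[OF assms(4)] assms)

lemma left_act_cmult:
  "left_act \<omega> (\<lambda>g. c * a g) F = (\<lambda>p. c * left_act \<omega> a F p)"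
  "left_act \<omega> a (\<lambda>p. c * F p) = (\<lambda>p. c * left_act \<omega> a F p)"
  unfolding left_act_def
  by (simp_all add: pairing_cmult_left mult.left_commute[of _ c] pairing_cmult_right)

lemma right_act_add_algebra:
  assumes "weight \<omega>" "a abs_summable_on UNIV" "b abs_summable_on UNIV" "bounded (range F)"
  shows "right_act \<omega> F (\<lambda>g. a g + b g) = (\<lambda>p. right_act \<omega> F a p + right_act \<omega> F b p)"
  unfolding right_act_def
  by (intro ext pairing_add_left bounded_range_intros bounded_range_compose[OF assms(4)] assms)

lemma right_act_add:
  assumes "weight \<omega>" "a abs_summable_on UNIV" "bounded (range F)" "bounded (range G)"
  shows "right_act \<omega> (\<lambda>p. F p + G p) a = (\<lambda>p. right_act \<omega> F a p + right_act \<omega> G a p)"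
  unfolding right_act_def distrib_left
  by (intro ext pairing_add_right bounded_range_intros bounded_range_compose[OF assms(3)]
      bounded_range_compose[OF assms(4)] assms)

lemma right_act_cmult:
  "right_act \<omega> F (\<lambda>g. c * a g) = (\<lambda>p. c * right_act \<omega> F a p)"
  "right_act \<omega> (\<lambda>p. c * F p) a = (\<lambda>p. c * right_act \<omega> F a p)"
  unfolding right_act_def
  by (simp_all add: pairing_cmult_left mult.left_commute[of _ c] pairing_cmult_right)

lemma kernel_bimodule_banach:
  fixes \<omega> :: "'s::monoid_mult \<Rightarrow> real"
  assumes w: "weight \<omega>" "\<omega> 1 = 1"
  shows "banach_bimodule (beurling_algebra \<omega>) (kernel_bimodule \<omega>)"
proof (intro banach_bimodule.intro banach_bimodule_axioms.intro, goal_cases)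
  case 1
  show ?case by (rule linf_banach_space) (simp_all only: kernel_bimodule_simps)
next
  case 15
  have "vnorm (kernel_bimodule \<omega>) (lact (kernel_bimodule \<omega>) a F) \<le>
      2 * vnorm (beurling_algebra \<omega>) a * vnorm (kernel_bimodule \<omega>) F"
    if "a abs_summable_on UNIV" "bounded (range F)" for a F
    using sup_norm_le[OF kernel_proj_norm_le[OF w(1) left_act_norm_le[OF w(1) that(1) sup_norm_ge[OF that(2)]]]]
    by (simp add: kernel_bimodule_simps beurling_algebra_simps mult_ac)
  then show ?case by (auto simp: kernel_bimodule_simps(1) beurling_algebra_simps(1))
next
  case 16
  have "vnorm (kernel_bimodule \<omega>) (ract (kernel_bimodule \<omega>) F a) \<le>
      2 * vnorm (beurling_algebra \<omega>) a * vnorm (kernel_bimodule \<omega>) F"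
    if "a abs_summable_on UNIV" "bounded (range F)" for a F
    using sup_norm_le[OF kernel_proj_norm_le[OF w(1) right_act_norm_le[OF w(1) that(1) sup_norm_ge[OF that(2)]]]]
    by (simp add: kernel_bimodule_simps beurling_algebra_simps mult_ac)
  then show ?case by (auto simp: kernel_bimodule_simps(1) beurling_algebra_simps(1))
qed (auto simp: kernel_bimodule_simps beurling_algebra_simps w bounded_range_kernel_proj
      bounded_range_left_act bounded_range_right_act left_act_add_algebra left_act_add left_act_cmult
      right_act_add_algebra right_act_add right_act_cmult
      kernel_proj_add kernel_proj_cmult left_act_mult right_act_mult left_act_right_act
      kernel_proj_left_act kernel_proj_right_act)

section \<open>From amenability to a diagonal\<close>

text \<open>The functional \<open>F \<mapsto> F(k, 1) - F(1, k)\<close> is \<open>\<delta>\<^sub>k \<cdot> (\<delta>\<^sub>1 \<otimes> \<delta>\<^sub>1) - (\<delta>\<^sub>1 \<otimes> \<delta>\<^sub>1) \<cdot> \<delta>\<^sub>k\<close>.  It lies in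
  \<open>(ker \<pi>)\<^sup>*\<^sup>*\<close>, that is, it factors through the projection.\<close>

lemma kernel_proj_commutator:
  "weight \<omega> \<Longrightarrow> \<omega> 1 = 1 \<Longrightarrow>
    kernel_proj \<omega> F (k, 1) - kernel_proj \<omega> F (1, k) = F (k, 1) - F (1, k)"
  by (simp add: kernel_proj_def mult_adjoint_def weight_ratio_one)

text \<open>The Leibniz rule of the derivation \<open>a \<mapsto> a \<cdot> (\<delta>\<^sub>1 \<otimes> \<delta>\<^sub>1) - (\<delta>\<^sub>1 \<otimes> \<delta>\<^sub>1) \<cdot> a\<close>.  The projections in
  the two actions can be dropped by \<open>kernel_proj_commutator\<close>, and then the mixed term \<open>F(k, l)\<close>, that is
  \<open>\<langle>a \<otimes> b, F\<rangle>\<close>, occurs on the right-hand side twice with opposite signs.\<close>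

lemma commutator_leibniz:
  assumes w: "weight \<omega>" "\<omega> 1 = 1" and a: "a abs_summable_on UNIV" and b: "b abs_summable_on UNIV"
    and F: "bounded (range F)"
  defines "G \<equiv> kernel_proj \<omega> (left_act \<omega> b F)" and "H \<equiv> kernel_proj \<omega> (right_act \<omega> F a)"
  shows "pairing (beurling_mult \<omega> a b) (\<lambda>k. F (k, 1) - F (1, k)) =
    pairing a (\<lambda>k. G (k, 1) - G (1, k)) + pairing b (\<lambda>l. H (l, 1) - H (1, l))"
proof -
  note bdd = bounded_range_intros w a b bounded_range_compose[OF F]
  let ?X = "\<lambda>k l. weight_ratio \<omega> k l * F (k * l, 1)"
  let ?Y = "\<lambda>k l. weight_ratio \<omega> k l * F (1, k * l)"
  let ?Z = "\<lambda>k l. F (k, l)"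
  have "pairing (beurling_mult \<omega> a b) (\<lambda>k. F (k, 1) - F (1, k)) =
      pairing a (\<lambda>k. pairing b (\<lambda>l. ?X k l - ?Y k l))"
    by (subst pairing_beurling_mult[OF w(1) a b], intro bdd) (simp add: right_diff_distrib)
  also have "\<dots> = pairing a (\<lambda>k. pairing b (?X k) - pairing b (?Y k))"
    by (subst pairing_diff_right[OF b], (intro bdd)+) rule
  also have "\<dots> = pairing a (\<lambda>k. pairing b (?X k)) - pairing a (\<lambda>k. pairing b (?Y k))"
    by (intro pairing_diff_right bdd)
  finally have lhs: "pairing (beurling_mult \<omega> a b) (\<lambda>k. F (k, 1) - F (1, k)) =
      pairing a (\<lambda>k. pairing b (?X k)) - pairing a (\<lambda>k. pairing b (?Y k))" .
  have "pairing a (\<lambda>k. G (k, 1) - G (1, k)) = pairing a (\<lambda>k. pairing b (?Z k) - pairing b (?Y k))"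
    unfolding G_def kernel_proj_commutator[OF w] by (simp add: left_act_def weight_ratio_one w)
  also have "\<dots> = pairing a (\<lambda>k. pairing b (?Z k)) - pairing a (\<lambda>k. pairing b (?Y k))"
    by (intro pairing_diff_right bdd)
  finally have rhs1: "pairing a (\<lambda>k. G (k, 1) - G (1, k)) =
      pairing a (\<lambda>k. pairing b (?Z k)) - pairing a (\<lambda>k. pairing b (?Y k))" .
  have "pairing b (\<lambda>l. H (l, 1) - H (1, l)) =
      pairing b (\<lambda>l. pairing a (\<lambda>k. ?X k l) - pairing a (\<lambda>k. ?Z k l))"
    unfolding H_def kernel_proj_commutator[OF w] by (simp add: right_act_def weight_ratio_one w)
  also have "\<dots> = pairing b (\<lambda>l. pairing a (\<lambda>k. ?X k l)) - pairing b (\<lambda>l. pairing a (\<lambda>k. ?Z k l))"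
    by (intro pairing_diff_right bdd)
  also have "pairing b (\<lambda>l. pairing a (\<lambda>k. ?X k l)) = pairing a (\<lambda>k. pairing b (?X k))"
    by (rule pairing_swap[OF a b, symmetric]) (intro bdd)
  also have "pairing b (\<lambda>l. pairing a (\<lambda>k. ?Z k l)) = pairing a (\<lambda>k. pairing b (?Z k))"
    by (rule pairing_swap[OF a b, symmetric]) (intro bdd)
  finally show ?thesis using lhs rhs1 by simp
qed

definition commutator_derivation ::
    "('s::monoid_mult \<Rightarrow> complex) \<Rightarrow> ('s \<times> 's \<Rightarrow> complex) \<Rightarrow> complex" where
  "commutator_derivation a = (\<lambda>F\<in>{F. bounded (range F)}. pairing a (\<lambda>k. F (k, 1) - F (1, k)))"

lemma derivation_commutator:
  fixes \<omega> :: "'s::monoid_mult \<Rightarrow> real"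
  assumes w: "weight \<omega>" "\<omega> 1 = 1"
  shows "derivation (beurling_algebra \<omega>) (dual_bimodule (kernel_bimodule \<omega>)) commutator_derivation"
proof -
  let ?E = "kernel_bimodule \<omega>"
  let ?norm = "\<lambda>F :: 's \<times> 's \<Rightarrow> complex. SUP p. cmod (F p)"
  have bdd: "bounded (range (\<lambda>k. F (k, 1) - F (1, k)))" if "bounded (range F)" for F :: "'s \<times> 's \<Rightarrow> complex"
    by (intro bounded_range_diff bounded_range_compose[OF that])
  have bound: "cmod (commutator_derivation a F) \<le> 2 * (\<Sum>\<^sub>\<infinity>g. cmod (a g)) * ?norm F"
    if a: "a abs_summable_on UNIV" and F: "bounded (range F)" for a F
  proof -
    have "cmod (F (k, 1) - F (1, k)) \<le> 2 * ?norm F" for k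
      unfolding mult_2 by (intro norm_triangle_le_diff add_mono sup_norm_ge[OF F])
    from pairing_norm_le[OF a this] show ?thesis
      using F by (simp add: commutator_derivation_def mult_ac)
  qed
  have mem: "commutator_derivation a \<in> carrier (dual_space ?E)" if a: "a abs_summable_on UNIV" for a
  proof -
    have "pairing a (\<lambda>k. (F (k, 1) + G (k, 1)) - (F (1, k) + G (1, k))) =
        pairing a (\<lambda>k. F (k, 1) - F (1, k)) + pairing a (\<lambda>k. G (k, 1) - G (1, k))"
      if "bounded (range F)" "bounded (range G)" for F G
      by (subst pairing_add_right[OF a bdd[OF that(1)] bdd[OF that(2)], symmetric])
        (simp add: algebra_simps)
    moreover have "pairing a (\<lambda>k. c * F (k, 1) - c * F (1, k)) = c * pairing a (\<lambda>k. F (k, 1) - F (1, k))"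
      for c and F :: "'s \<times> 's \<Rightarrow> complex"
      by (simp add: pairing_cmult_right[symmetric] right_diff_distrib)
    moreover have "\<exists>C. \<forall>F\<in>carrier ?E. cmod (commutator_derivation a F) \<le> C * vnorm ?E F"
      using bound[OF a] by (auto simp: kernel_bimodule_simps)
    ultimately show ?thesis
      by (simp add: dual_space_def kernel_bimodule_simps commutator_derivation_def
          bounded_range_add bounded_range_cmult)
  qed
  have norm: "vnorm (dual_space ?E) (commutator_derivation a) \<le> 2 * (\<Sum>\<^sub>\<infinity>g. cmod (a g))"
    if a: "a abs_summable_on UNIV" for a
    unfolding dual_space_def normed_space.simps
  proof (rule cSUP_least)
    show "{F \<in> carrier ?E. vnorm ?E F \<le> 1} \<noteq> {}"
      by (auto simp: kernel_bimodule_simps intro!: exI[of _ "\<lambda>_. 0"])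
    fix F assume F: "F \<in> {F \<in> carrier ?E. vnorm ?E F \<le> 1}"
    then have "2 * (\<Sum>\<^sub>\<infinity>g. cmod (a g)) * ?norm F \<le> 2 * (\<Sum>\<^sub>\<infinity>g. cmod (a g)) * 1"
      by (intro mult_left_mono) (auto simp: kernel_bimodule_simps infsum_nonneg)
    with bound[OF a, of F] F show "cmod (commutator_derivation a F) \<le> 2 * (\<Sum>\<^sub>\<infinity>g. cmod (a g))"
      by (simp add: kernel_bimodule_simps)
  qed
  show ?thesis
    unfolding derivation_def dual_bimodule_simps beurling_algebra_simps
  proof (intro conjI)
    show "\<exists>C. \<forall>a\<in>{a. a abs_summable_on UNIV}.
        vnorm (dual_space ?E) (commutator_derivation a) \<le> C * (\<Sum>\<^sub>\<infinity>g. cmod (a g))"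
      using norm by blast
    show "\<forall>a\<in>{a. a abs_summable_on UNIV}. \<forall>b\<in>{a. a abs_summable_on UNIV}.
        commutator_derivation (beurling_mult \<omega> a b) =
        (\<lambda>F\<in>carrier ?E. (\<lambda>F\<in>carrier ?E. commutator_derivation a (lact ?E b F)) F +
          (\<lambda>F\<in>carrier ?E. commutator_derivation b (ract ?E F a)) F)"
      by (auto simp: commutator_derivation_def kernel_bimodule_simps fun_eq_iff restrict_def
          bounded_range_kernel_proj bounded_range_left_act bounded_range_right_act commutator_leibniz w)
  qed (use mem bdd in \<open>auto simp: commutator_derivation_def kernel_bimodule_simps fun_eq_iff restrict_def
          pairing_add_left pairing_cmult_left\<close>)
qed

lemma dual_space_diff:
  fixes V :: "('i \<Rightarrow> complex, 'm) normed_space_scheme"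
  assumes \<phi>: "\<phi> \<in> carrier (dual_space V)"
    and V: "carrier V = {f. bounded (range f)}" "add V = (\<lambda>f g i. f i + g i)" "module.smult V = (\<lambda>c f i. c * f i)"
    and fg: "bounded (range f)" "bounded (range g)"
  shows "\<phi> (\<lambda>i. f i - g i) = \<phi> f - \<phi> g"
  using dual_space_add[OF \<phi>, of f "\<lambda>i. (-1) * g i"] dual_space_smult[OF \<phi>, of g "-1"]
    bounded_range_cmult[OF fg(2), of "-1"] fg
  by (simp add: V)

lemma linf_space_simps:
  "carrier linf_space = {f. bounded (range f)}"
  "add linf_space = (\<lambda>f g i. f i + g i)"
  "module.smult linf_space = (\<lambda>c f i. c * f i)"
  "vnorm linf_space = (\<lambda>f. SUP i. cmod (f i))"
  by (simp_all add: linf_space_def)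

text \<open>With \<open>\<phi>\<close> implementing the commutator derivation at \<open>\<delta>\<^sub>k\<close>, the diagonal is
  \<open>\<delta>\<^sub>1 \<otimes> \<delta>\<^sub>1 - \<phi> \<circ> P\<close>.  On the range of \<open>\<pi>\<^sup>*\<close> the second term vanishes and the first one evaluates at
  the unit, which is condition (ii); condition (i) says that both terms have the same commutator
  with \<open>\<delta>\<^sub>k\<close>.\<close>

lemma pointwise_amenable_at_imp_pointwise_diagonal:
  fixes \<omega> :: "'s::monoid_mult \<Rightarrow> real"
  assumes w: "weight \<omega>" "\<omega> 1 = 1"
    and amenable: "pointwise_amenable_at TYPE('s \<times> 's \<Rightarrow> complex) (beurling_algebra \<omega>) (point_mass k)"
  shows "\<exists>M\<in>carrier (dual_space linf_space). pointwise_diagonal \<omega> k M"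
proof -
  let ?E = "kernel_bimodule \<omega>"
  interpret E: banach_bimodule "beurling_algebra \<omega>" ?E by (rule kernel_bimodule_banach[OF w])
  obtain \<phi> where \<phi>: "\<phi> \<in> carrier (dual_space ?E)"
    and eq: "commutator_derivation (point_mass k) =
      (\<lambda>F\<in>carrier ?E. \<phi> (ract ?E F (point_mass k))) \<ominus>\<^bsub>dual_space ?E\<^esub>
      (\<lambda>F\<in>carrier ?E. \<phi> (lact ?E (point_mass k) F))"
    using amenable E.banach_bimodule_axioms derivation_commutator[OF w]
    unfolding pointwise_amenable_at_def dual_bimodule_simps by blast
  note k = point_mass_abs_summable[of k]
  have kA: "point_mass k \<in> carrier (beurling_algebra \<omega>)" using k by (simp add: beurling_algebra_simps)
  note \<phi>_diff = dual_space_diff[OF \<phi>, unfolded kernel_bimodule_simps, OF refl refl refl]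
  have key: "F (k, 1) - F (1, k) =
      \<phi> (kernel_proj \<omega> (right_act \<omega> F (point_mass k))) - \<phi> (kernel_proj \<omega> (left_act \<omega> (point_mass k) F))"
    if F: "bounded (range F)" for F
    using fun_cong[OF eq, of F] F
    by (simp add: E.dual_minus E.dual_lact_closed E.dual_ract_closed \<phi> kA)
      (simp add: kernel_bimodule_simps commutator_derivation_def pairing_point_mass)
  define M where "M = (\<lambda>F\<in>carrier linf_space. F (1, 1) - \<phi> (kernel_proj \<omega> F))"
  have M: "M F = F (1, 1) - \<phi> (kernel_proj \<omega> F)" if "bounded (range F)" for F
    using that by (simp add: M_def linf_space_simps)
  have "M \<in> carrier (dual_space linf_space)"
  proof -
    obtain C where C: "\<And>F. bounded (range F) \<Longrightarrow> cmod (\<phi> F) \<le> C * (SUP p. cmod (F p))"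
      using dual_space_bound[OF \<phi>] unfolding kernel_bimodule_simps by blast
    have "cmod (M F) \<le> (1 + 2 * \<bar>C\<bar>) * (SUP p. cmod (F p))" if F: "bounded (range F)" for F
    proof -
      note PF = bounded_range_kernel_proj[OF w(1) F]
      have "cmod (\<phi> (kernel_proj \<omega> F)) \<le> C * (SUP p. cmod (kernel_proj \<omega> F p))" by (rule C[OF PF])
      also have "\<dots> \<le> \<bar>C\<bar> * (2 * (SUP p. cmod (F p)))"
        by (intro mult_mono sup_norm_le kernel_proj_norm_le[OF w(1)] sup_norm_ge[OF F] sup_norm_nonneg[OF PF]) auto
      finally have "cmod (M F) \<le> (SUP p. cmod (F p)) + \<bar>C\<bar> * (2 * (SUP p. cmod (F p)))"
        unfolding M[OF F] by (intro norm_triangle_le_diff add_mono sup_norm_ge[OF F])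
      then show ?thesis by (simp add: algebra_simps)
    qed
    then have "\<exists>C. \<forall>F\<in>carrier linf_space. cmod (M F) \<le> C * vnorm linf_space F"
      by (auto simp: linf_space_simps)
    moreover have "M (\<lambda>p. F p + G p) = M F + M G" if "bounded (range F)" "bounded (range G)" for F G
      using dual_space_add[OF \<phi>, of "kernel_proj \<omega> F" "kernel_proj \<omega> G"] that
      by (simp add: M bounded_range_add kernel_proj_add kernel_bimodule_simps bounded_range_kernel_proj w)
    moreover have "M (\<lambda>p. c * F p) = c * M F" if "bounded (range F)" for c F
      using dual_space_smult[OF \<phi>, of "kernel_proj \<omega> F" c] that
      by (simp add: M bounded_range_cmult kernel_proj_cmult kernel_bimodule_simps
          bounded_range_kernel_proj w algebra_simps)
    ultimately show ?thesis by (simp add: dual_space_def linf_space_simps(1-3)) (simp add: M_def linf_space_simps)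
  qed
  moreover have "pointwise_diagonal \<omega> k M"
    unfolding pointwise_diagonal_def
  proof (intro conjI allI impI)
    fix f :: "'s \<times> 's \<Rightarrow> complex" assume f: "bounded (range f)"
    \<comment> \<open>\<^const>\<open>pointwise_diagonal\<close> passes its arguments to \<open>f\<close> in reversed order.\<close>
    let ?F = "\<lambda>p. f (snd p, fst p)"
    let ?L = "left_act \<omega> (point_mass k) ?F" and ?R = "right_act \<omega> ?F (point_mass k)"
    have F: "bounded (range ?F)" by (rule bounded_range_compose[OF f])
    note LR = bounded_range_left_act[OF w(1) k F] bounded_range_right_act[OF w(1) k F]
    have "(\<lambda>(g, h). f (h * k, g) * weight_ratio \<omega> h k - f (h, k * g) * weight_ratio \<omega> k g) =
        (\<lambda>p. ?L p - ?R p)"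
      by (auto simp: left_act_def right_act_def pairing_point_mass)
    moreover have "M (\<lambda>p. ?L p - ?R p) = 0"
    proof -
      have "M (\<lambda>p. ?L p - ?R p) =
          ?L (1, 1) - ?R (1, 1) - (\<phi> (kernel_proj \<omega> ?L) - \<phi> (kernel_proj \<omega> ?R))"
        by (simp add: M bounded_range_diff LR kernel_proj_diff \<phi>_diff bounded_range_kernel_proj w)
      also have "?L (1, 1) - ?R (1, 1) = ?F (1, k) - ?F (k, 1)"
        by (simp add: left_act_def right_act_def pairing_point_mass weight_ratio_one w)
      also have "\<dots> - (\<phi> (kernel_proj \<omega> ?L) - \<phi> (kernel_proj \<omega> ?R)) =
          (\<phi> (kernel_proj \<omega> ?R) - \<phi> (kernel_proj \<omega> ?L)) - (?F (k, 1) - ?F (1, k))"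
        by simp
      also have "\<dots> = 0" unfolding key[OF F] by simp
      finally show ?thesis .
    qed
    ultimately show "M (\<lambda>(g, h). f (h * k, g) * weight_ratio \<omega> h k - f (h, k * g) * weight_ratio \<omega> k g) = 0"
      by simp
  next
    fix f :: "'s \<Rightarrow> complex" assume f: "bounded (range f)"
    have "\<phi> (\<lambda>_. 0) = 0"
      using dual_space_smult[OF \<phi>, of "\<lambda>_. 0" 0] by (simp add: kernel_bimodule_simps)
    then have "M (mult_adjoint \<omega> f) = f 1"
      by (simp add: M bounded_range_mult_adjoint w f kernel_proj_mult_adjoint)
        (simp add: mult_adjoint_def weight_ratio_one w)
    then show "M (\<lambda>(g, h). f (g * h) * weight_ratio \<omega> g h) = f 1"
      by (simp add: mult_adjoint_def case_prod_unfold mult.commute)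
  qed
  ultimately show ?thesis by blast
qed

section \<open>From a diagonal to amenability\<close>

text \<open>Integrating \<open>\<delta>\<^sub>g \<cdot> D \<delta>\<^sub>h\<close> against the diagonal implements \<open>\<delta>\<^sub>1 \<cdot> D \<delta>\<^sub>k\<close>: moving \<open>\<delta>\<^sub>k\<close> across \<open>D \<delta>\<^sub>h\<close>
  with the Leibniz rule produces the commutator family of condition (i), which contributes nothing,
  and \<open>\<delta>\<^sub>g \<delta>\<^sub>h \<cdot> D \<delta>\<^sub>k\<close>, which condition (ii) evaluates.  The correction
  \<open>\<delta>\<^sub>1 \<cdot> D \<delta>\<^sub>1 - D \<delta>\<^sub>1\<close> accounts for the part of \<open>D\<close> that a module without unit law leaves over.\<close>

lemma pointwise_diagonal_imp_pointwise_amenable_at: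
  fixes \<omega> :: "'s::monoid_mult \<Rightarrow> real"
  assumes w: "weight \<omega>" "\<omega> 1 = 1"
    and M: "M \<in> carrier (dual_space linf_space)" and diag: "pointwise_diagonal \<omega> k M"
  shows "pointwise_amenable_at TYPE('v) (beurling_algebra \<omega>) (point_mass k)"
  unfolding pointwise_amenable_at_def
proof (intro allI impI)
  let ?A = "beurling_algebra \<omega>"
  let ?\<delta> = "point_mass :: 's \<Rightarrow> 's \<Rightarrow> complex"
  fix E :: "('s \<Rightarrow> complex, 'v) bimodule" and D
  assume "banach_bimodule ?A E" and der: "derivation ?A (dual_bimodule E) D"
  then interpret E: banach_bimodule ?A E by simp
  have \<delta>: "?\<delta> g \<in> carrier ?A" for g
    using point_mass_abs_summable by (simp add: beurling_algebra_simps)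
  have \<delta>\<delta>: "?\<delta> g \<otimes>\<^bsub>?A\<^esub> ?\<delta> h = weight_ratio \<omega> g h \<odot>\<^bsub>?A\<^esub> ?\<delta> (g * h)" for g h
    by (simp add: beurling_algebra_simps beurling_mult_point_mass)
  have unit: "?\<delta> 1 \<otimes>\<^bsub>?A\<^esub> ?\<delta> g = ?\<delta> g" "?\<delta> g \<otimes>\<^bsub>?A\<^esub> ?\<delta> 1 = ?\<delta> g" for g
    by (simp_all add: \<delta>\<delta> weight_ratio_one w) (simp_all add: beurling_algebra_simps)
  have D: "D a \<in> carrier (dual_space E)" if "a \<in> carrier ?A" for a
    using der that unfolding derivation_def dual_bimodule_simps by blast
  have D_smult: "D (c \<odot>\<^bsub>?A\<^esub> a) x = c * D a x" if "a \<in> carrier ?A" "x \<in> carrier E" for a c x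
    using der that unfolding derivation_def dual_bimodule_simps by simp
  have D_mult: "D (a \<otimes>\<^bsub>?A\<^esub> b) x = D a (lact E b x) + D b (ract E x a)"
    if "a \<in> carrier ?A" "b \<in> carrier ?A" "x \<in> carrier E" for a b x
    using der that unfolding derivation_def dual_bimodule_simps by simp
  obtain CD where CD: "\<And>a. a \<in> carrier ?A \<Longrightarrow> vnorm (dual_space E) (D a) \<le> CD * vnorm ?A a"
    using der unfolding derivation_def dual_bimodule_simps by blast
  obtain CR where CR: "\<And>a x. \<lbrakk>a \<in> carrier ?A; x \<in> carrier E\<rbrakk> \<Longrightarrow>
      vnorm E (ract E x a) \<le> CR * vnorm ?A a * vnorm E x"
    using E.ract_bounded by blast
  have \<delta>norm: "vnorm ?A (?\<delta> g) = 1" for g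
    by (simp add: beurling_algebra_simps point_mass_norm)

  let ?F = "\<lambda>x p. D (?\<delta> (snd p)) (ract E x (?\<delta> (fst p)))"
  have F_le: "cmod (?F x p) \<le> \<bar>CD\<bar> * (\<bar>CR\<bar> * vnorm E x)" if x: "x \<in> carrier E" for x p
  proof -
    let ?y = "ract E x (?\<delta> (fst p))"
    have y: "?y \<in> carrier E" by (rule E.ract_closed[OF \<delta> x])
    have "cmod (?F x p) \<le> vnorm (dual_space E) (D (?\<delta> (snd p))) * vnorm E ?y"
      by (rule E.dual_norm_bound[OF D[OF \<delta>] y])
    also have "\<dots> \<le> \<bar>CD\<bar> * (\<bar>CR\<bar> * vnorm E x)"
    proof (rule mult_mono)
      show "vnorm (dual_space E) (D (?\<delta> (snd p))) \<le> \<bar>CD\<bar>"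
        using CD[OF \<delta>, of "snd p"] by (simp add: \<delta>norm)
      have "CR * vnorm E x \<le> \<bar>CR\<bar> * vnorm E x"
        by (intro mult_right_mono E.vnorm_nonneg[OF x]) simp
      then show "vnorm E ?y \<le> \<bar>CR\<bar> * vnorm E x"
        using CR[OF \<delta> x, of "fst p"] by (simp add: \<delta>norm)
    qed (use E.vnorm_nonneg[OF y] in auto)
    finally show ?thesis .
  qed
  have F_bdd: "bounded (range (?F x))" if x: "x \<in> carrier E" for x
    using F_le[OF x] unfolding bounded_range_iff
    by (intro exI[of _ "\<bar>CD\<bar> * (\<bar>CR\<bar> * vnorm E x)"]) (simp add: E.vnorm_nonneg[OF x])
  define \<phi>0 where "\<phi>0 = (\<lambda>x\<in>carrier E. M (?F x))"
  have \<phi>0: "\<phi>0 \<in> carrier (dual_space E)"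
  proof -
    obtain CM where CM: "\<And>F. bounded (range F) \<Longrightarrow> cmod (M F) \<le> CM * (SUP p. cmod (F p))"
      using dual_space_bound[OF M] unfolding linf_space_simps by blast
    have "cmod (\<phi>0 x) \<le> (\<bar>CM\<bar> * \<bar>CD\<bar> * \<bar>CR\<bar>) * vnorm E x" if x: "x \<in> carrier E" for x
    proof -
      have "cmod (M (?F x)) \<le> CM * (SUP p. cmod (?F x p))" by (rule CM[OF F_bdd[OF x]])
      also have "\<dots> \<le> \<bar>CM\<bar> * (\<bar>CD\<bar> * (\<bar>CR\<bar> * vnorm E x))"
        by (intro mult_mono sup_norm_le F_le[OF x] sup_norm_nonneg[OF F_bdd[OF x]]) auto
      finally show ?thesis using x by (simp add: \<phi>0_def mult.assoc)
    qed
    then have "\<exists>C. \<forall>x\<in>carrier E. cmod (\<phi>0 x) \<le> C * vnorm E x" by blast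
    moreover have "\<phi>0 (x \<oplus>\<^bsub>E\<^esub> y) = \<phi>0 x + \<phi>0 y" if "x \<in> carrier E" "y \<in> carrier E" for x y
      using dual_space_add[OF M, of "?F x" "?F y"] that F_bdd
      by (simp add: \<phi>0_def linf_space_simps E.ract_add_left \<delta> E.ract_closed dual_space_add[OF D[OF \<delta>]])
    moreover have "\<phi>0 (c \<odot>\<^bsub>E\<^esub> x) = c * \<phi>0 x" if "x \<in> carrier E" for c x
      using dual_space_smult[OF M, of "?F x" c] that F_bdd E.smult_closed[of c x]
      by (simp add: \<phi>0_def linf_space_simps E.ract_smult_left \<delta> E.ract_closed dual_space_smult[OF D[OF \<delta>]]
          ring_of_type_algebra_def)
    ultimately show ?thesis by (simp add: dual_space_def) (simp add: \<phi>0_def)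
  qed
  have inner: "\<phi>0 (ract E x (?\<delta> k)) - \<phi>0 (lact E (?\<delta> k) x) = D (?\<delta> k) (ract E x (?\<delta> 1))"
    if x: "x \<in> carrier E" for x
  proof -
    note closed = E.ract_closed[OF \<delta>] E.lact_closed[OF \<delta>] x
    let ?f = "\<lambda>p. ?F x (snd p, fst p)"
    let ?u = "\<lambda>g. D (?\<delta> k) (ract E x (?\<delta> g))"
    let ?I = "\<lambda>(g, h). ?f (h * k, g) * weight_ratio \<omega> h k - ?f (h, k * g) * weight_ratio \<omega> k g"
    let ?J = "\<lambda>(g, h). ?u (g * h) * weight_ratio \<omega> g h"
    have f: "bounded (range ?f)" by (rule bounded_range_compose[OF F_bdd[OF x]])
    have u: "bounded (range ?u)"
      using bounded_range_compose[OF F_bdd[OF x], of "\<lambda>g. (g, k)"] by simp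
    have R: "D (?\<delta> h) (ract E (ract E x (?\<delta> k)) (?\<delta> g)) = ?f (h, k * g) * weight_ratio \<omega> k g" for g h
      using closed
      by (simp add: E.ract_mult[symmetric] \<delta> \<delta>\<delta> E.ract_smult_right dual_space_smult[OF D[OF \<delta>]])
    have L: "D (?\<delta> h) (ract E (lact E (?\<delta> k) x) (?\<delta> g)) =
        ?f (h * k, g) * weight_ratio \<omega> h k - ?u (g * h) * weight_ratio \<omega> g h" for g h
    proof -
      let ?y = "ract E x (?\<delta> g)"
      have y: "?y \<in> carrier E" by (intro closed)
      have "D (?\<delta> h) (lact E (?\<delta> k) ?y) = D (?\<delta> h \<otimes>\<^bsub>?A\<^esub> ?\<delta> k) ?y - D (?\<delta> k) (ract E ?y (?\<delta> h))"
        by (simp add: D_mult \<delta> y)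
      also have "\<dots> = ?f (h * k, g) * weight_ratio \<omega> h k - ?u (g * h) * weight_ratio \<omega> g h"
        using closed
        by (simp add: E.ract_mult[symmetric] \<delta> \<delta>\<delta> E.ract_smult_right D_smult dual_space_smult[OF D[OF \<delta>]])
      finally show ?thesis by (simp add: E.lact_ract \<delta> x)
    qed
    note M_diff = dual_space_diff[OF M, unfolded linf_space_simps, OF refl refl refl]
    have J: "bounded (range ?J)"
      using bounded_range_mult_adjoint[OF w(1) u]
      by (simp add: mult_adjoint_def case_prod_unfold mult.commute)
    have I: "?I = (\<lambda>p. ?F (lact E (?\<delta> k) x) p - (?F (ract E x (?\<delta> k)) p - ?J p))"
      by (simp add: fun_eq_iff L R)
    have "M ?I = M (?F (lact E (?\<delta> k) x)) - (M (?F (ract E x (?\<delta> k))) - M ?J)"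
      unfolding I
      by (subst M_diff M_diff[OF _ J], (intro F_bdd closed J bounded_range_diff)+)+ rule
    moreover have "M ?I = 0" "M ?J = ?u 1"
      using diag f u unfolding pointwise_diagonal_def by blast+
    ultimately show ?thesis using closed by (simp add: \<phi>0_def)
  qed

  \<comment> \<open>\<open>\<psi>\<close> is \<open>\<delta>\<^sub>1 \<cdot> D \<delta>\<^sub>1\<close>, so \<open>\<psi> - D \<delta>\<^sub>1\<close> is killed by \<open>\<delta>\<^sub>k\<close> from the left, and its negative times \<open>\<delta>\<^sub>k\<close>
    is \<open>D \<delta>\<^sub>1 \<cdot> \<delta>\<^sub>k\<close> because \<open>\<psi> \<cdot> \<delta>\<^sub>k\<close> vanishes;
    by the Leibniz rule for \<open>\<delta>\<^sub>1 \<delta>\<^sub>k\<close> this is \<open>D \<delta>\<^sub>k - \<delta>\<^sub>1 \<cdot> D \<delta>\<^sub>k\<close>.\<close>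
  let ?e = "?\<delta> 1"
  define \<psi> where "\<psi> = (\<lambda>x\<in>carrier E. D ?e (ract E x ?e))"
  define \<phi> where "\<phi> = (\<lambda>x\<in>carrier E. \<phi>0 x - D ?e x + \<psi> x)"
  have \<psi>: "\<psi> \<in> carrier (dual_space E)"
    unfolding \<psi>_def by (rule E.dual_lact_closed[OF D[OF \<delta>] \<delta>])
  have \<phi>: "\<phi> \<in> carrier (dual_space E)"
  proof -
    note E.dual_linear_combination[OF \<phi>0 D[OF \<delta>], of 1 "-1" 1]
    from E.dual_linear_combination[OF this \<psi>, of 1 1] show ?thesis
      by (simp add: \<phi>_def cong: restrict_cong)
  qed
  have eDe: "D ?e (ract E (lact E ?e x) ?e) = 0" if x: "x \<in> carrier E" for x
  proof -
    let ?y = "ract E x ?e"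
    have y: "?y \<in> carrier E" by (rule E.ract_closed[OF \<delta> x])
    have "ract E ?y ?e = ?y" using x by (simp add: E.ract_mult[symmetric] \<delta> unit)
    with D_mult[OF \<delta> \<delta> y, of 1 1] show ?thesis by (simp add: unit E.lact_ract \<delta> x)
  qed
  have "D (?\<delta> k) x = \<phi> (ract E x (?\<delta> k)) - \<phi> (lact E (?\<delta> k) x)" if x: "x \<in> carrier E" for x
  proof -
    note closed = E.ract_closed[OF \<delta>] E.lact_closed[OF \<delta>] x
    have "ract E (ract E x (?\<delta> k)) ?e = ract E x (?\<delta> k)"
      using x by (simp add: E.ract_mult[symmetric] \<delta> unit)
    then have 1: "\<phi> (ract E x (?\<delta> k)) = \<phi>0 (ract E x (?\<delta> k))"
      using closed by (simp add: \<phi>_def \<psi>_def)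
    have "lact E ?e (lact E (?\<delta> k) x) = lact E (?\<delta> k) x"
      using x by (simp add: E.lact_mult[symmetric] \<delta> unit)
    with eDe[of "lact E (?\<delta> k) x"] have 2: "\<phi> (lact E (?\<delta> k) x) = \<phi>0 (lact E (?\<delta> k) x) - D ?e (lact E (?\<delta> k) x)"
      using closed by (simp add: \<phi>_def \<psi>_def)
    have "D (?\<delta> k) x = D ?e (lact E (?\<delta> k) x) + D (?\<delta> k) (ract E x ?e)"
      using D_mult[OF \<delta> \<delta> x, of 1 k] by (simp add: unit)
    with 1 2 inner[OF x] show ?thesis by simp
  qed
  then have "D (?\<delta> k) = (\<lambda>x\<in>carrier E. \<phi> (ract E x (?\<delta> k)) - \<phi> (lact E (?\<delta> k) x))"
    using D[OF \<delta>, of k] by (auto simp: dual_space_def extensional_def fun_eq_iff)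
  also have "\<dots> = (\<lambda>x\<in>carrier E. \<phi> (ract E x (?\<delta> k))) \<ominus>\<^bsub>dual_space E\<^esub>
      (\<lambda>x\<in>carrier E. \<phi> (lact E (?\<delta> k) x))"
    by (simp add: E.dual_minus E.dual_lact_closed E.dual_ract_closed \<phi> \<delta> cong: restrict_cong)
  finally show "\<exists>\<phi>\<in>carrier (dual_bimodule E). D (?\<delta> k) =
      lact (dual_bimodule E) (?\<delta> k) \<phi> \<ominus>\<^bsub>dual_bimodule E\<^esub> ract (dual_bimodule E) \<phi> (?\<delta> k)"
    using \<phi> unfolding dual_bimodule_simps by blast
qed

section \<open>Pointwise amenability of Beurling algebras\<close>

theorem theorem4p3:
  fixes \<omega> :: "'s::monoid_mult \<Rightarrow> real"
  assumes "weight \<omega>" and "\<omega> 1 = 1"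
  shows
    "(pointwise_amenable TYPE('s \<times> 's \<Rightarrow> complex) (beurling_algebra \<omega>) \<longrightarrow>
        (\<forall>k. \<exists>M \<in> carrier (dual_space linf_space). pointwise_diagonal \<omega> k M)) \<and>
     ((\<forall>k. \<exists>M \<in> carrier (dual_space linf_space). pointwise_diagonal \<omega> k M) \<longrightarrow>
        (\<forall>k. pointwise_amenable_at TYPE('v) (beurling_algebra \<omega>) (point_mass k)))"
proof (intro conjI impI allI)
  fix k
  assume "pointwise_amenable TYPE('s \<times> 's \<Rightarrow> complex) (beurling_algebra \<omega>)"
  moreover have "point_mass k \<in> carrier (beurling_algebra \<omega>)"
    using point_mass_abs_summable by (simp add: beurling_algebra_simps)
  ultimately have "pointwise_amenable_at TYPE('s \<times> 's \<Rightarrow> complex) (beurling_algebra \<omega>) (point_mass k)"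
    unfolding pointwise_amenable_def by blast
  then show "\<exists>M \<in> carrier (dual_space linf_space). pointwise_diagonal \<omega> k M"
    by (rule pointwise_amenable_at_imp_pointwise_diagonal[OF assms])
next
  fix k
  assume "\<forall>k. \<exists>M \<in> carrier (dual_space linf_space). pointwise_diagonal \<omega> k M"
  then obtain M where "M \<in> carrier (dual_space linf_space)" "pointwise_diagonal \<omega> k M" by blast
  then show "pointwise_amenable_at TYPE('v) (beurling_algebra \<omega>) (point_mass k)"
    by (rule pointwise_diagonal_imp_pointwise_amenable_at[OF assms])
qed

end
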